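(* Let $Y\subset Q=\mathbb P^1\times\mathbb P^1$ be a zero-dimensional scheme and let $$0\to\bigoplus_{i=1}^t\mathscr O_Q(-a_{3i},-a'_{3i})\to\bigoplus_{i=1}^n\mathscr O_Q(-a_{2i},-a'_{2i})\to\bigoplus_{i=1}^m\mathscr O_Q(-a_{1i},-a'_{1i})\to\mathscr I_Y\to0$$ be the minimal free resolution of $Y$. Let $P\in Y$ with $m_Y(P)=1$ and let $Z=Y\setminus\{P\}$. Suppose that there exist $r,s\in\mathbb N$ such that: (1) $P$ has just one minimal separating degree for $Y$, namely $(r,s)$; (2) $(r,s)\nless(a_{1i},a'_{1i})$ for every $i=1,\dots,m$; (3) $(r+1,s+1)\neq(a_{2i},a'_{2i})$ for every $i=1,\dots,n$. Then the minimal free resolution of $Z$ is $$0\to\bigoplus_{i=1}^t\mathscr O_Q(-a_{3i},-a'_{3i})\oplus\mathscr O_Q(-r-1,-s-1)\to\bigoplus_{i=1}^n\mathscr O_Q(-a_{2i},-a'_{2i})\oplus\mathscr O_Q(-r-1,-s)\oplus\mathscr O_Q(-r,-s-1)\to$$ $$\to\bigoplus_{i=1}^m\mathscr O_Q(-a_{1i},-a'_{1i})\oplus\mathscr O_Q(-r,-s)\to\mathscr I_Z\to0.$$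
   Context: Let $k$ be an algebraically closed field, $Q=\mathbb P^1_k\times\mathbb P^1_k$, and $S=\bigoplus_{a,b\ge0}H^0\mathscr O_Q(a,b)$, the bigraded ring $k[x_0,x_1,y_0,y_1]$ with $\deg x_i=(1,0)$, $\deg y_i=(0,1)$. For a zero-dimensional scheme $Y\subset Q$, $I_Y\subset S$ is its saturated bihomogeneous ideal and $\mathscr I_Y$ its ideal sheaf. Bidegrees are partially ordered componentwise: $(i_1,j_1)\ge(i_2,j_2)$ iff $i_1\ge i_2$ and $j_1\ge j_2$; $(i_1,j_1)<(i_2,j_2)$ means $(i_1,j_1)\le(i_2,j_2)$ and $(i_1,j_1)\ne(i_2,j_2)$. Minimal free resolution of $Y$: a resolution of $\mathscr I_Y$ by finite direct sums of sheaves $\mathscr O_Q(-a,-a')$ that comes from the minimal bigraded free $S$-resolution of $I_Y$ (with $S(-a,-a')$ corresponding to $\mathscr O_Q(-a,-a')$); in particular it stays exact on global sections after every twist. For $P\in Y$, $m_Y(P)$ is the length of $\mathscr O_{Y,P}$. Write $I_Y=\bigcap_{P'\in Y}J_{P'}$ where $\sqrt{J_{P'}}=I_{P'}$ is the ideal of the point $P'$. If $m_Y(P)=1$, $Y\setminus\{P\}$ is the scheme with ideal $\bigcap_{P'\in Y\setminus\{P\}}J_{P'}$, and a bihomogeneous $f\in S$ is a separator for $P\in Y$ if $f(P)\ne0$ and $f\in\bigcap_{P'\in Y\setminus\{P\}}J_{P'}$. A minimal separating degree for $P$ is the degree $\deg f$ of a separator $f$ such that no separator $g$ for $P\in Y$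 has $\deg g<\deg f$. *)

theory Defs
  imports
    "HOL-Library.Poly_Mapping"
    "HOL-Library.Product_Order"
    "HOL-Library.Product_Plus"
    "HOL-Library.Extended_Nat"
    "HOL-Computational_Algebra.Polynomial"
    "HOL-Computational_Algebra.Fraction_Field"
    "HOL-Algebra.QuotRing"
    "Jordan_Normal_Form.Matrix_Kernel"
begin

section \<open>The bigraded ring $S = k[x_0,x_1,y_0,y_1]$\<close>

datatype var = X0 | X1 | Y0 | Y1

instance var :: finite
proof
  have "(UNIV :: var set) \<subseteq> {X0, X1, Y0, Y1}"
    using var.exhaust by blast
  then show "finite (UNIV :: var set)"
    using finite_subset by blast
qed

text \<open>The order on the variables only serves to obtain the library's \<open>idom\<close> instance for
  polynomials (through the induced order on monomials).\<close>

primrec var_index :: "var \<Rightarrow> nat" where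
  "var_index X0 = 0" | "var_index X1 = 1" | "var_index Y0 = 2" | "var_index Y1 = 3"

instantiation var :: linorder
begin
definition less_eq_var :: "var \<Rightarrow> var \<Rightarrow> bool" where
  "u \<le> v \<longleftrightarrow> var_index u \<le> var_index v"
definition less_var :: "var \<Rightarrow> var \<Rightarrow> bool" where
  "u < v \<longleftrightarrow> var_index u < var_index v"
instance
proof
  fix u v :: var
  show "u \<le> v \<Longrightarrow> v \<le> u \<Longrightarrow> u = v"
    by (cases u; cases v) (auto simp: less_eq_var_def)
qed (auto simp: less_eq_var_def less_var_def)
end

type_synonym 'k bipoly = "(var \<Rightarrow>\<^sub>0 nat) \<Rightarrow>\<^sub>0 'k"

definition Var :: "var \<Rightarrow> 'k::field bipoly" where
  "Var v = Poly_Mapping.single (Poly_Mapping.single v 1) 1"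

definition bideg :: "(var \<Rightarrow>\<^sub>0 nat) \<Rightarrow> int \<times> int" where
  "bideg m = (int (Poly_Mapping.lookup m X0 + Poly_Mapping.lookup m X1),
              int (Poly_Mapping.lookup m Y0 + Poly_Mapping.lookup m Y1))"

text \<open>Membership in the graded piece $S_d$; for $d \not\ge (0,0)$ only the zero polynomial
  qualifies.\<close>

definition bihom :: "int \<times> int \<Rightarrow> 'k::field bipoly \<Rightarrow> bool" where
  "bihom d f \<longleftrightarrow> (\<forall>m \<in> Poly_Mapping.keys f. bideg m = d)"

definition poly_eval :: "(var \<Rightarrow> 'k) \<Rightarrow> 'k::field bipoly \<Rightarrow> 'k" where
  "poly_eval c f =
     (\<Sum>m \<in> Poly_Mapping.keys f.
        Poly_Mapping.lookup f m * (\<Prod>v \<in> UNIV. c v ^ Poly_Mapping.lookup m v))"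

abbreviation polyring :: "'k::field bipoly ring" where
  "polyring \<equiv> class_ring"

definition bihom_ideal :: "'k::field bipoly set \<Rightarrow> bool" where
  "bihom_ideal I \<longleftrightarrow> ideal I polyring \<and> genideal polyring {f \<in> I. \<exists>d. bihom d f} = I"

definition irrelevant_ideal :: "'k::field bipoly set" where
  "irrelevant_ideal = genideal polyring {Var x * Var y | x y. x \<in> {X0, X1} \<and> y \<in> {Y0, Y1}}"

text \<open>$(I : B) = I$ for $B = (x_0,x_1)\cap(y_0,y_1)$; this is the same as $(I : B^\infty) = I$.\<close>

definition saturated :: "'k::field bipoly set \<Rightarrow> bool" where
  "saturated I \<longleftrightarrow> (\<forall>f. (\<forall>g \<in> irrelevant_ideal. g * f \<in> I) \<longrightarrow> f \<in> I)"

definition radical :: "'k::field bipoly set \<Rightarrow> 'k bipoly set" where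
  "radical I = {f. \<exists>n. f ^ n \<in> I}"

definition primary :: "'k::field bipoly set \<Rightarrow> bool" where
  "primary I \<longleftrightarrow> ideal I polyring \<and> I \<noteq> UNIV \<and>
     (\<forall>f g. f * g \<in> I \<longrightarrow> f \<in> I \<or> g \<in> radical I)"


section \<open>Points of $Q = \mathbf P^1 \times \mathbf P^1$\<close>

definition proj1_rel :: "'k::field \<times> 'k \<Rightarrow> 'k \<times> 'k \<Rightarrow> bool" where
  "proj1_rel u v \<longleftrightarrow> u \<noteq> (0, 0) \<and> v \<noteq> (0, 0) \<and>
     (\<exists>c. c \<noteq> 0 \<and> v = (c * fst u, c * snd u))"

quotient_type (overloaded) 'k proj1 = "'k::field \<times> 'k" / partial: proj1_rel
proof (rule part_equivpI)
  show "\<exists>u :: 'k \<times> 'k. proj1_rel u u"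
    by (rule exI[of _ "(1, 1)"]) (auto simp: proj1_rel_def intro!: exI[of _ 1])
  show "symp (proj1_rel :: 'k \<times> 'k \<Rightarrow> _)"
  proof (rule sympI)
    fix u v :: "'k \<times> 'k"
    assume "proj1_rel u v"
    then obtain c where "u \<noteq> (0, 0)" "v \<noteq> (0, 0)" "c \<noteq> 0" "v = (c * fst u, c * snd u)"
      unfolding proj1_rel_def by blast
    then show "proj1_rel v u"
      by (auto simp: proj1_rel_def prod_eq_iff intro!: exI[of _ "inverse c"])
  qed
  show "transp (proj1_rel :: 'k \<times> 'k \<Rightarrow> _)"
  proof (rule transpI)
    fix u v w :: "'k \<times> 'k"
    assume uv: "proj1_rel u v" and vw: "proj1_rel v w"
    from uv obtain c where "c \<noteq> 0" "v = (c * fst u, c * snd u)"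
      unfolding proj1_rel_def by blast
    moreover from vw obtain d where "d \<noteq> 0" "w = (d * fst v, d * snd v)"
      unfolding proj1_rel_def by blast
    ultimately have "d * c \<noteq> 0 \<and> w = (d * c * fst u, d * c * snd u)"
      by (simp add: mult.assoc)
    with uv vw show "proj1_rel u w"
      unfolding proj1_rel_def by blast
  qed
qed

type_synonym 'k point = "'k proj1 \<times> 'k proj1"

text \<open>A choice of bihomogeneous coordinates. \<open>value_at f P\<close> is only used to decide whether a
  bihomogeneous \<open>f\<close> vanishes at \<open>P\<close>, which does not depend on the choice.\<close>

definition coords :: "'k::field point \<Rightarrow> var \<Rightarrow> 'k" where
  "coords P v = (case v of
      X0 \<Rightarrow> fst (rep_proj1 (fst P)) | X1 \<Rightarrow> snd (rep_proj1 (fst P))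
    | Y0 \<Rightarrow> fst (rep_proj1 (snd P)) | Y1 \<Rightarrow> snd (rep_proj1 (snd P)))"

definition value_at :: "'k::field bipoly \<Rightarrow> 'k point \<Rightarrow> 'k" where
  "value_at f P = poly_eval (coords P) f"

definition point_ideal :: "'k::field point \<Rightarrow> 'k bipoly set" where
  "point_ideal P = genideal polyring {f. (\<exists>d. bihom d f) \<and> value_at f P = 0}"


section \<open>Zero-dimensional subschemes of $Q$\<close>

text \<open>A closed subscheme $Y \subset Q$ is given by its saturated bihomogeneous ideal $I_Y$.\<close>

definition support :: "'k::field bipoly set \<Rightarrow> 'k point set" where
  "support I = {P. \<forall>f \<in> I. (\<exists>d. bihom d f) \<longrightarrow> value_at f P = 0}"

definition zero_dim_scheme :: "'k::field bipoly set \<Rightarrow> bool" where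
  "zero_dim_scheme I \<longleftrightarrow>
     bihom_ideal I \<and> saturated I \<and> finite (support I) \<and> support I \<noteq> {}"

text \<open>$\mathscr O_{Q,P}$ as a subring of the fraction field of $S$, and the stalk at $P$ of the
  ideal sheaf of $Y$.\<close>

definition local_ring :: "'k::field point \<Rightarrow> 'k bipoly fract ring" where
  "local_ring P = class_ring\<lparr>carrier :=
     {Fract f g | f g. value_at g P \<noteq> 0 \<and> (\<exists>d. bihom d f \<and> bihom d g)}\<rparr>"

definition ideal_stalk :: "'k::field bipoly set \<Rightarrow> 'k point \<Rightarrow> 'k bipoly fract set" where
  "ideal_stalk I P =
     {Fract f g | f g. f \<in> I \<and> value_at g P \<noteq> 0 \<and> (\<exists>d. bihom d f \<and> bihom d g)}"

text \<open>The length of a commutative ring as a module over itself: the supremum of the lengths of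
  strictly increasing chains of ideals.\<close>

definition ring_length :: "('a, 'b) ring_scheme \<Rightarrow> enat" where
  "ring_length R = Sup {enat n | n. \<exists>A :: nat \<Rightarrow> 'a set.
     (\<forall>i \<le> n. ideal (A i) R) \<and> (\<forall>i < n. A i \<subset> A (Suc i))}"

definition multiplicity_at :: "'k::field bipoly set \<Rightarrow> 'k point \<Rightarrow> enat" where
  "multiplicity_at I P = ring_length (local_ring P Quot ideal_stalk I P)"

text \<open>The decomposition $I_Y = \bigcap_{P \in Y} J_P$ with $\sqrt{J_P} = I_P$. The $J_P$ are
  required to be primary, which makes them unique.\<close>

definition point_decomposition ::
    "'k::field bipoly set \<Rightarrow> ('k point \<Rightarrow> 'k bipoly set) \<Rightarrow> bool" where
  "point_decomposition I J \<longleftrightarrow>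
     I = (\<Inter>P \<in> support I. J P) \<and>
     (\<forall>P \<in> support I. primary (J P) \<and> radical (J P) = point_ideal P)"

text \<open>The ideal of $Y \setminus \{P\}$; it is $S$ when $Y$ is supported at $P$ only.\<close>

definition remove_point ::
    "'k::field bipoly set \<Rightarrow> ('k point \<Rightarrow> 'k bipoly set) \<Rightarrow> 'k point \<Rightarrow> 'k bipoly set" where
  "remove_point I J P = (\<Inter>P' \<in> support I - {P}. J P')"


section \<open>Separators\<close>

definition separator ::
    "'k::field bipoly set \<Rightarrow> ('k point \<Rightarrow> 'k bipoly set) \<Rightarrow> 'k point \<Rightarrow> int \<times> int \<Rightarrow> 'k bipoly \<Rightarrow> bool"
  where
  "separator I J P d f \<longleftrightarrow> bihom d f \<and> value_at f P \<noteq> 0 \<and> f \<in> remove_point I J P"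

text \<open>The order on \<open>int \<times> int\<close> is the componentwise one.\<close>

definition minimal_separating_degree ::
    "'k::field bipoly set \<Rightarrow> ('k point \<Rightarrow> 'k bipoly set) \<Rightarrow> 'k point \<Rightarrow> int \<times> int \<Rightarrow> bool" where
  "minimal_separating_degree I J P d \<longleftrightarrow>
     (\<exists>f. separator I J P d f) \<and> \<not> (\<exists>e g. separator I J P e g \<and> e < d)"


section \<open>Minimal bigraded free resolutions\<close>

text \<open>The matrix (acting on column vectors) of a homomorphism of bidegree $(0,0)$ from
  $\bigoplus_j S(-b_j)$ to $\bigoplus_i S(-a_i)$.\<close>

definition graded_map :: "(int \<times> int) list \<Rightarrow> (int \<times> int) list \<Rightarrow> 'k::field bipoly mat \<Rightarrow> bool" where
  "graded_map b a A \<longleftrightarrow> A \<in> carrier_mat (length a) (length b) \<and>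
     (\<forall>i < length a. \<forall>j < length b. bihom (b ! j - a ! i) (A $$ (i, j)))"

definition mat_image :: "'k::field bipoly mat \<Rightarrow> 'k bipoly vec set" where
  "mat_image A = (\<lambda>v. A *\<^sub>v v) ` carrier_vec (dim_col A)"

definition variables_ideal :: "'k::field bipoly set" where
  "variables_ideal = genideal polyring (range Var)"

text \<open>The complex
  $0 \to \bigoplus S(-a_{3i}) \to \bigoplus S(-a_{2i}) \to \bigoplus S(-a_{1i}) \to I \to 0$
  given by \<open>A\<^sub>3\<close>, \<open>A\<^sub>2\<close>, \<open>A\<^sub>1\<close> is exact, and the two maps between free modules send the
  source into $(x_0,x_1,y_0,y_1)$ times the target. The resolution of the ideal sheaf of a
  zero-dimensional scheme with saturated ideal \<open>I\<close> is the associated complex of sheaves,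
  $S(-a,-a')$ corresponding to $\mathscr O_Q(-a,-a')$.\<close>

definition minimal_free_resolution ::
    "'k::field bipoly set \<Rightarrow> (int \<times> int) list \<Rightarrow> (int \<times> int) list \<Rightarrow> (int \<times> int) list \<Rightarrow>
     'k bipoly mat \<Rightarrow> 'k bipoly mat \<Rightarrow> 'k bipoly mat \<Rightarrow> bool" where
  "minimal_free_resolution I a\<^sub>1 a\<^sub>2 a\<^sub>3 A\<^sub>1 A\<^sub>2 A\<^sub>3 \<longleftrightarrow>
     graded_map a\<^sub>1 [(0, 0)] A\<^sub>1 \<and> graded_map a\<^sub>2 a\<^sub>1 A\<^sub>2 \<and> graded_map a\<^sub>3 a\<^sub>2 A\<^sub>3 \<and>
     (\<lambda>v. v $ 0) ` mat_image A\<^sub>1 = I \<and>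
     mat_kernel A\<^sub>1 = mat_image A\<^sub>2 \<and>
     mat_kernel A\<^sub>2 = mat_image A\<^sub>3 \<and>
     mat_kernel A\<^sub>3 = {0\<^sub>v (length a\<^sub>3)} \<and>
     elements_mat A\<^sub>2 \<subseteq> variables_ideal \<and>
     elements_mat A\<^sub>3 \<subseteq> variables_ideal"

end

theory Submission
  imports Defs "HOL-Algebra.Subrings"
begin

text \<open>Multiplicity one forces \<open>J P\<close> to be the prime ideal \<open>(l, m)\<close> of \<open>P\<close>, where \<open>l\<close> and \<open>m\<close> are the
  linear forms in \<open>x\<close> and in \<open>y\<close> vanishing at \<open>P\<close>. Then \<open>I\<^sub>Z\<close> consists of the \<open>g\<close> with \<open>l g, m g \<in> I\<^sub>Y\<close>, so
  it is bihomogeneous, and since \<open>(r, s)\<close> is the only minimal separating degree, subtracting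
  multiples of a separator \<open>f\<close> of degree \<open>(r, s)\<close> gives \<open>I\<^sub>Z = I\<^sub>Y + (f)\<close>, while
  \<open>(I\<^sub>Y : f) = (l, m)\<close>. Hence \<open>I\<^sub>Z / I\<^sub>Y\<close> is \<open>(S / (l, m))(-r, -s)\<close>, resolved by a Koszul complex, and
  the horseshoe lemma combines it with the resolution of \<open>I\<^sub>Y\<close>. The entries of the off-diagonal
  blocks are bihomogeneous, and the two conditions on the degrees imply that none of them has
  degree zero, which is minimality.\<close>

section \<open>Bihomogeneous polynomials\<close>

text \<open>Reduces claims that are additive in the polynomial to single terms.\<close>

lemma poly_mapping_induct [case_names zero single add]:
  fixes P :: "('a \<Rightarrow>\<^sub>0 'b::comm_monoid_add) \<Rightarrow> bool"
  assumes "P 0" "\<And>m c. P (Poly_Mapping.single m c)"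
    and "\<And>p q. P p \<Longrightarrow> P q \<Longrightarrow> P (p + q)"
  shows "P p"
proof (induction p rule: update_induct)
  case const
  show ?case by fact
next
  case (update f a b)
  \<comment> \<open>The induction only ever updates a key outside the support, so the update is a
    sum.\<close>
  have "Poly_Mapping.update a b f = f + Poly_Mapping.single a b"
    using update(1) by (intro poly_mapping_eqI)
      (auto simp: lookup_update lookup_add lookup_single in_keys_iff when_def)
  then show ?case using assms update by metis
qed

lemma bihom_iff: "bihom d f \<longleftrightarrow> (\<forall>m. Poly_Mapping.lookup f m \<noteq> 0 \<longrightarrow> bideg m = d)"
  by (auto simp: bihom_def in_keys_iff)

lemma bideg_add: "bideg (m + n) = bideg m + bideg n"
  by (simp add: bideg_def lookup_add)

lemma bideg_zero: "bideg 0 = (0, 0)"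
  by (simp add: bideg_def)

lemma bihom_zero [simp]: "bihom d 0"
  by (simp add: bihom_iff)

lemma bihom_single: "bideg m = d \<Longrightarrow> bihom d (Poly_Mapping.single m c)"
  by (auto simp: bihom_iff lookup_single when_def)

lemma bihom_add: "bihom d f \<Longrightarrow> bihom d g \<Longrightarrow> bihom d (f + g)"
  unfolding bihom_iff lookup_add by (metis add_0)

lemma bihom_uminus: "bihom d f \<Longrightarrow> bihom d (- f)"
  by (simp add: bihom_iff)

lemma bihom_diff: "bihom d f \<Longrightarrow> bihom d g \<Longrightarrow> bihom d (f - g)"
  using bihom_add[of d f "- g"] bihom_uminus[of d g] by simp

lemma bihom_mult:
  assumes "bihom d f" "bihom e g"
  shows "bihom (d + e) (f * g)"
  unfolding bihom_def
proof
  fix m assume "m \<in> Poly_Mapping.keys (f * g)"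
  then obtain a b where "m = a + b" "a \<in> Poly_Mapping.keys f" "b \<in> Poly_Mapping.keys g"
    using keys_mult by blast
  then show "bideg m = d + e" using assms by (simp add: bihom_def bideg_add)
qed

text \<open>A nonzero polynomial has a monomial, and exponents are natural numbers. Bidegrees are
  integers because differences of generator degrees may leave the quadrant.\<close>

lemma bihom_nonneg:
  assumes "bihom d f" "f \<noteq> 0"
  obtains i j where "d = (int i, int j)"
  using assms unfolding bihom_iff bideg_def by (metis lookup_zero poly_mapping_eqI)

text \<open>The projection of \<open>S\<close> onto its piece of bidegree \<open>d\<close>. It is
  zero for \<open>d\<close> outside the quadrant, so differences of degrees need no case
  distinction.\<close>

definition hcomp :: "int \<times> int \<Rightarrow> 'k::field bipoly \<Rightarrow> 'k bipoly" where
  "hcomp d f = Poly_Mapping.mapp (\<lambda>m c. c when bideg m = d) f"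

lemma lookup_hcomp: "Poly_Mapping.lookup (hcomp d f) m = (Poly_Mapping.lookup f m when bideg m = d)"
  by (auto simp: hcomp_def lookup_mapp when_def in_keys_iff)

lemma bihom_hcomp: "bihom d (hcomp d f)"
  by (auto simp: bihom_iff lookup_hcomp when_def)

lemma hcomp_zero [simp]: "hcomp d 0 = 0"
  by (intro poly_mapping_eqI) (simp add: lookup_hcomp)

lemma hcomp_add: "hcomp d (f + g) = hcomp d f + hcomp d g"
  by (intro poly_mapping_eqI) (simp add: lookup_hcomp lookup_add when_add_distrib)

lemma hcomp_sum: "hcomp d (\<Sum>i\<in>X. f i) = (\<Sum>i\<in>X. hcomp d (f i))"
  by (induction X rule: infinite_finite_induct) (auto simp: hcomp_add)

lemma hcomp_same: "bihom d f \<Longrightarrow> hcomp d f = f"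
  by (intro poly_mapping_eqI) (auto simp: lookup_hcomp bihom_iff when_def)

lemma hcomp_other: "bihom d f \<Longrightarrow> e \<noteq> d \<Longrightarrow> hcomp e f = 0"
  by (intro poly_mapping_eqI) (auto simp: lookup_hcomp bihom_iff when_def)

lemma sum_hcomp: "(\<Sum>d\<in>bideg ` Poly_Mapping.keys f. hcomp d f) = f"
proof (intro poly_mapping_eqI)
  fix m
  have "(\<Sum>d\<in>bideg ` Poly_Mapping.keys f. Poly_Mapping.lookup f m when bideg m = d)
      = Poly_Mapping.lookup f m"
    by (auto simp: when_def in_keys_iff image_iff)
  then show "Poly_Mapping.lookup (\<Sum>d\<in>bideg ` Poly_Mapping.keys f. hcomp d f) m
      = Poly_Mapping.lookup f m"
    by (simp add: lookup_sum lookup_hcomp)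
qed

text \<open>Both sides are additive in \<open>q\<close>. For a single term the product is a form of
  bidegree \<open>d + bideg m\<close>, so both sides survive or vanish together.\<close>

lemma hcomp_mult:
  assumes "bihom d p"
  shows "hcomp (d + e) (p * q) = p * hcomp e q"
proof (induction q rule: poly_mapping_induct)
  case (single m c)
  have hom: "bihom (d + bideg m) (p * Poly_Mapping.single m c)"
    by (intro bihom_mult assms bihom_single) simp
  show ?case
  proof (cases "bideg m = e")
    case True
    then show ?thesis using hom by (auto simp: hcomp_same bihom_single)
  next
    case False
    then have "d + e \<noteq> d + bideg m" by simp
    then show ?thesis
      using hcomp_other[OF hom] False hcomp_other[of "bideg m" "Poly_Mapping.single m c" e]
      by (simp add: bihom_single)
  qed
qed (simp_all add: hcomp_add distrib_left)

text \<open>The general induction is run on \<open>hcomp d q\<close> for arbitrary \<open>q\<close>: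
  terms of any other bidegree become zero and need no hypothesis.\<close>

lemma bihom_induct [consumes 1, case_names zero single add]:
  fixes p :: "'k::field bipoly"
  assumes "bihom d p" and "P 0"
    and "\<And>m c. bideg m = d \<Longrightarrow> P (Poly_Mapping.single m c)"
    and "\<And>p q. P p \<Longrightarrow> P q \<Longrightarrow> P (p + q)"
  shows "P p"
proof -
  have "P (hcomp d q)" for q
  proof (induction q rule: poly_mapping_induct)
    case (single m c)
    then show ?case
      using assms(2) assms(3)[of m c] hcomp_same[OF bihom_single, of m d c]
        hcomp_other[OF bihom_single[OF refl], of d m c]
      by (cases "bideg m = d") simp_all
  qed (simp_all add: hcomp_add assms)
  then show ?thesis using hcomp_same[OF assms(1)] by metis
qed

abbreviation const :: "'k::field \<Rightarrow> 'k bipoly" where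
  "const \<equiv> Poly_Mapping.single 0"

lemma bihom_const: "bihom (0, 0) (const c)"
  by (intro bihom_single bideg_zero)

lemma bihom_Var: "bihom (if v \<in> {X0, X1} then (1, 0) else (0, 1)) (Var v)"
  unfolding Var_def by (intro bihom_single) (cases v; simp add: bideg_def lookup_single when_def)

lemma bihom_const_mult: "bihom d f \<Longrightarrow> bihom d (const c * f)"
  using bihom_mult[OF bihom_const] by (simp add: zero_prod_def[symmetric])

lemma UNIV_var: "(UNIV :: var set) = {X0, X1, Y0, Y1}"
  using var.exhaust by auto

section \<open>Evaluation and substitution\<close>

text \<open>Evaluation at a point (\<open>C = id\<close>) and substitution of polynomials for the
  variables (\<open>C = const\<close>) are treated at once.\<close>

definition eval_with ::
    "('k \<Rightarrow> 'r::comm_ring_1) \<Rightarrow> (var \<Rightarrow> 'r) \<Rightarrow> 'k::field bipoly \<Rightarrow> 'r" where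
  "eval_with C c f = (\<Sum>m \<in> Poly_Mapping.keys f.
     C (Poly_Mapping.lookup f m) * (\<Prod>v \<in> UNIV. c v ^ Poly_Mapping.lookup m v))"

lemma poly_eval_eq: "poly_eval = eval_with id"
  by (intro ext) (simp add: poly_eval_def eval_with_def)

locale coefficient_hom =
  fixes C :: "'k::field \<Rightarrow> 'r::comm_ring_1"
  assumes C_zero [simp]: "C 0 = 0" and C_one [simp]: "C 1 = 1"
    and C_add: "C (a + b) = C a + C b" and C_mult: "C (a * b) = C a * C b"
begin

lemma eval_zero [simp]: "eval_with C c 0 = 0"
  by (simp add: eval_with_def)

lemma eval_superset:
  assumes "finite X" "Poly_Mapping.keys f \<subseteq> X"
  shows "eval_with C c f =
    (\<Sum>m \<in> X. C (Poly_Mapping.lookup f m) * (\<Prod>v \<in> UNIV. c v ^ Poly_Mapping.lookup m v))"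
  unfolding eval_with_def using assms
  by (intro sum.mono_neutral_left) (auto simp: in_keys_iff)

lemma eval_add: "eval_with C c (f + g) = eval_with C c f + eval_with C c g"
proof -
  let ?X = "Poly_Mapping.keys f \<union> Poly_Mapping.keys g"
  have "Poly_Mapping.keys (f + g) \<subseteq> ?X" by (rule keys_add)
  then show ?thesis
    by (simp add: eval_superset[of ?X] lookup_add C_add distrib_right sum.distrib)
qed

lemma eval_single:
  "eval_with C c (Poly_Mapping.single m a) = C a * (\<Prod>v \<in> UNIV. c v ^ Poly_Mapping.lookup m v)"
  by (cases "a = 0") (auto simp: eval_with_def)

lemma eval_const [simp]: "eval_with C c (const a) = C a"
  by (simp add: eval_single)

lemma eval_Var [simp]: "eval_with C c (Var w) = c w"
  unfolding Var_def eval_single by (cases w) (simp_all add: UNIV_var lookup_single)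

lemma eval_mult: "eval_with C c (f * g) = eval_with C c f * eval_with C c g"
proof (induction f rule: poly_mapping_induct)
  case (single m a)
  show ?case
  proof (induction g rule: poly_mapping_induct)
    case (single n b)
    show ?case
      by (simp add: mult_single eval_single C_mult lookup_add power_add prod.distrib)
  qed (simp_all add: distrib_left eval_add)
qed (simp_all add: distrib_right eval_add)

lemma eval_uminus: "eval_with C c (- f) = - eval_with C c f"
  using eval_add[of c f "- f"] by (simp add: eq_neg_iff_add_eq_0 add.commute)

lemma eval_diff: "eval_with C c (f - g) = eval_with C c f - eval_with C c g"
  using eval_add[of c f "- g"] eval_uminus by simp

lemma eval_power: "eval_with C c (f ^ n) = eval_with C c f ^ n"
proof (induction n)
  case 0
  show ?case using eval_const[of c 1] by simp
qed (simp add: eval_mult)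

end

interpretation ev: coefficient_hom id
  by unfold_locales auto

interpretation su: coefficient_hom const
  by unfold_locales (auto simp: single_add mult_single)

text \<open>Expresses a term through ring operations, so that divisibility and congruences can be
  checked variable by variable.\<close>

lemma single_eq_monomial:
  "Poly_Mapping.single m c = const c * (\<Prod>v\<in>UNIV. Var v ^ Poly_Mapping.lookup m v)"
proof -
  have "Var v ^ n = Poly_Mapping.single (Poly_Mapping.single v n) (1::'a)" for v n
    by (induction n) (auto simp: Var_def mult_single single_add[symmetric])
  moreover have "m = (\<Sum>v\<in>UNIV. Poly_Mapping.single v (Poly_Mapping.lookup m v))"
  proof (intro poly_mapping_eqI)
    fix w
    show "Poly_Mapping.lookup m w =
        Poly_Mapping.lookup (\<Sum>v\<in>UNIV. Poly_Mapping.single v (Poly_Mapping.lookup m v)) w"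
      by (cases w) (simp_all add: UNIV_var lookup_add lookup_single)
  qed
  ultimately show ?thesis
    by (simp add: UNIV_var mult_single add.assoc)
qed

section \<open>Ideals\<close>

lemma ideal_class_ringI:
  assumes "0 \<in> I" "\<And>a b. a \<in> I \<Longrightarrow> b \<in> I \<Longrightarrow> a + b \<in> I" "\<And>a b. a \<in> I \<Longrightarrow> b * a \<in> I"
  shows "ideal I (class_ring :: 'a::comm_ring_1 ring)"
proof (rule idealI)
  show "ring (class_ring :: 'a ring)" by (rule class_ring.ring_axioms)
  have minus: "- a \<in> I" if "a \<in> I" for a
    using assms(3)[OF that, of "- 1"] by simp
  have inv: "inv\<^bsub>add_monoid (class_ring :: 'a ring)\<^esub> a = - a" for a
    using class_ring_simps(8) by (metis a_inv_def)
  show "subgroup I (add_monoid (class_ring :: 'a ring))"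
    using assms minus unfolding subgroup_def inv by (auto simp: class_ring_simps)
qed (use assms in \<open>auto simp: class_ring_simps mult.commute\<close>)

lemma ideal_class_ringD:
  assumes "ideal I (class_ring :: 'a::comm_ring_1 ring)"
  shows "0 \<in> I" "a \<in> I \<Longrightarrow> b \<in> I \<Longrightarrow> a + b \<in> I" "a \<in> I \<Longrightarrow> b * a \<in> I" "a \<in> I \<Longrightarrow> a * b \<in> I"
    "a \<in> I \<Longrightarrow> - a \<in> I" "a \<in> I \<Longrightarrow> b \<in> I \<Longrightarrow> a - b \<in> I"
proof -
  interpret ideal I "class_ring :: 'a ring" by fact
  show "0 \<in> I" "a \<in> I \<Longrightarrow> b \<in> I \<Longrightarrow> a + b \<in> I" and mult: "\<And>a b. a \<in> I \<Longrightarrow> b * a \<in> I"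
    using zero_closed a_closed I_l_closed by (auto simp: class_ring_simps)
  then show "a \<in> I \<Longrightarrow> a * b \<in> I" by (simp add: mult.commute)
  show minus: "a \<in> I \<Longrightarrow> - a \<in> I" for a using mult[of a "- 1"] by simp
  show "a \<in> I \<Longrightarrow> b \<in> I \<Longrightarrow> a - b \<in> I" 
    using minus[of b] a_closed[of a "- b"] by (simp add: class_ring_simps)
qed

lemma genideal_incl: "S \<subseteq> genideal polyring S"
  by (rule ring.genideal_self[OF class_ring.ring_axioms]) (simp add: class_ring_simps)

lemma ideal_genideal: "ideal (genideal polyring S) polyring"
  by (rule ring.genideal_ideal[OF class_ring.ring_axioms]) (simp add: class_ring_simps)

lemma genideal_least: "ideal I polyring \<Longrightarrow> S \<subseteq> I \<Longrightarrow> genideal polyring S \<subseteq> I"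
  by (rule ring.genideal_minimal[OF class_ring.ring_axioms])

lemma ideal_sum:
  assumes "ideal I (class_ring :: 'a::comm_ring_1 ring)" "\<And>i. i \<in> X \<Longrightarrow> f i \<in> I"
  shows "(\<Sum>i\<in>X. f i) \<in> I"
  using assms(2) by (induction X rule: infinite_finite_induct) (auto intro: ideal_class_ringD[OF assms(1)])

text \<open>The polynomials with all components in \<open>I\<close> form an ideal, and it contains
  the bihomogeneous generators of \<open>I\<close>.\<close>

lemma bihom_ideal_hcomp:
  assumes "bihom_ideal I" "f \<in> I"
  shows "hcomp d f \<in> I"
proof -
  let ?K = "{f. \<forall>d. hcomp d f \<in> I}"
  have I: "ideal I polyring" using assms(1) by (simp add: bihom_ideal_def)
  note ID = ideal_class_ringD[OF I]
  have "ideal ?K polyring"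
  proof (rule ideal_class_ringI)
    fix a b assume a: "a \<in> ?K"
    show "b * a \<in> ?K"
    proof (induction b rule: poly_mapping_induct)
      case (single m c)
      have "hcomp e (Poly_Mapping.single m c * a) = Poly_Mapping.single m c * hcomp (e - bideg m) a" for e
        using hcomp_mult[OF bihom_single[OF refl], of m "e - bideg m" c a] by simp
      moreover have "hcomp e a \<in> I" for e using a by blast
      ultimately show ?case using ID(3) by simp
    qed (auto simp: hcomp_add distrib_right ID)
  qed (auto simp: hcomp_add ID)
  moreover have "{f \<in> I. \<exists>d. bihom d f} \<subseteq> ?K"
  proof clarify
    fix f d e assume "f \<in> I" "bihom d f"
    then show "hcomp e f \<in> I" using hcomp_same hcomp_other ID(1) by metis
  qed
  ultimately have "genideal polyring {f \<in> I. \<exists>d. bihom d f} \<subseteq> ?K" by (rule genideal_least)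
  then show ?thesis using assms unfolding bihom_ideal_def by blast
qed

text \<open>Every monomial of nonzero bidegree is divisible by some variable. Minimality of a graded
  map can therefore be read off from degrees.\<close>

lemma bihom_in_variables_ideal:
  assumes "bihom d f" "d \<noteq> (0, 0)"
  shows "f \<in> variables_ideal"
proof -
  note ID = ideal_class_ringD[OF ideal_genideal[of "range Var"], folded variables_ideal_def]
  have Var: "Var v \<in> variables_ideal" for v
    unfolding variables_ideal_def by (rule subsetD[OF genideal_incl]) simp
  show ?thesis using assms(1)
  proof (induction rule: bihom_induct)
    case (single m c)
    have "\<exists>v. Poly_Mapping.lookup m v \<noteq> 0"
      using single assms(2) by (auto simp: bideg_def)
    then obtain v n where "Poly_Mapping.lookup m v = Suc n" using not0_implies_Suc by blast
    then have "Var v dvd (Var v :: 'a bipoly) ^ Poly_Mapping.lookup m v" by simp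
    also have "\<dots> dvd (\<Prod>v\<in>UNIV. Var v ^ Poly_Mapping.lookup m v)"
      by (rule dvd_prodI) auto
    also have "\<dots> dvd Poly_Mapping.single m c" unfolding single_eq_monomial[of m c] by simp
    finally show ?case using ID(4)[OF Var] by (auto simp: dvd_def)
  qed (auto intro: ID)
qed

text \<open>Congruence modulo \<open>I\<close> respects sums, products and powers, so agreement on
  the variables propagates to all polynomials.\<close>

lemma subst_congruent:
  assumes I: "ideal I polyring" and "\<And>v. Var v - s v \<in> I"
  shows "f - eval_with const s f \<in> I"
proof -
  note ID = ideal_class_ringD[OF I]
  have mult: "f * g - f' * g' \<in> I" if "f - f' \<in> I" "g - g' \<in> I" for f f' g g' :: "'a bipoly"
  proof -
    have "f * g - f' * g' = (f - f') * g + f' * (g - g')" by (simp add: algebra_simps)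
    then show ?thesis using that ID by metis
  qed
  have pow: "Var v ^ n - s v ^ n \<in> I" for v n
    by (induction n) (auto intro: mult assms ID)
  show ?thesis
  proof (induction f rule: poly_mapping_induct)
    case (single m c)
    show ?case
      by (subst single_eq_monomial, subst su.eval_single) (simp add: UNIV_var, intro mult pow, simp add: ID)
  next
    case (add p q)
    then have "(p - eval_with const s p) + (q - eval_with const s q) \<in> I" by (rule ID)
    then show ?case by (simp add: su.eval_add algebra_simps)
  qed (simp add: ID)
qed

section \<open>Coordinates and forms at a point\<close>

lemma bihom_power: "bihom (i, j) f \<Longrightarrow> bihom (int n * i, int n * j) (f ^ n)"
proof (induction n)
  case 0
  show ?case using bihom_const[of 1] by simp
next
  case (Suc n)
  then have "bihom ((i, j) + (int n * i, int n * j)) (f * f ^ n)" by (intro bihom_mult) auto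
  then show ?case by (simp add: algebra_simps)
qed

section \<open>The two linear forms at a point and reduction modulo them\<close>

definition xform :: "(var \<Rightarrow> 'k) \<Rightarrow> 'k::field bipoly" where
  "xform c = const (c X1) * Var X0 - const (c X0) * Var X1"

definition yform :: "(var \<Rightarrow> 'k) \<Rightarrow> 'k::field bipoly" where
  "yform c = const (c Y1) * Var Y0 - const (c Y0) * Var Y1"

text \<open>A scaled variable with value 1 at \<open>c\<close>, provided that the two coordinates
  are not both zero. Products of powers of \<open>xunit c\<close> and \<open>yunit c\<close> give a
  form with value 1 in every bidegree of the quadrant.\<close>

definition xunit :: "(var \<Rightarrow> 'k) \<Rightarrow> 'k::field bipoly" where
  "xunit c = (if c X0 \<noteq> 0 then const (1 / c X0) * Var X0 else const (1 / c X1) * Var X1)"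

definition yunit :: "(var \<Rightarrow> 'k) \<Rightarrow> 'k::field bipoly" where
  "yunit c = (if c Y0 \<noteq> 0 then const (1 / c Y0) * Var Y0 else const (1 / c Y1) * Var Y1)"

lemma bihom_xform: "bihom (1, 0) (xform c)" and bihom_xunit: "bihom (1, 0) (xunit c)"
  unfolding xform_def xunit_def
  using bihom_Var[of X0] bihom_Var[of X1] by (auto intro!: bihom_diff bihom_const_mult)

lemma bihom_yform: "bihom (0, 1) (yform c)" and bihom_yunit: "bihom (0, 1) (yunit c)"
  unfolding yform_def yunit_def
  using bihom_Var[of Y0] bihom_Var[of Y1] by (auto intro!: bihom_diff bihom_const_mult)

lemmas poly_eval_simps [simp] =
  ev.eval_add[folded poly_eval_eq] ev.eval_mult[folded poly_eval_eq]
  ev.eval_diff[folded poly_eval_eq] ev.eval_uminus[folded poly_eval_eq]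
  ev.eval_power[folded poly_eval_eq] ev.eval_zero[folded poly_eval_eq]
  ev.eval_Var[folded poly_eval_eq] ev.eval_const[folded poly_eval_eq, unfolded id_apply]

lemma poly_eval_one [simp]: "poly_eval c 1 = 1"
  using poly_eval_simps(8)[of c 1] by simp

lemma poly_eval_xform: "poly_eval d (xform c) = c X1 * d X0 - c X0 * d X1"
  by (simp add: xform_def)

lemma poly_eval_yform: "poly_eval d (yform c) = c Y1 * d Y0 - c Y0 * d Y1"
  by (simp add: yform_def)

lemma const_mult_inverse: "a \<noteq> 0 \<Longrightarrow> const a * (const (1 / a) * f) = (f :: 'k::field bipoly)"
  by (simp add: mult.assoc[symmetric] mult_single)

text \<open>Where \<open>xform c\<close> vanishes, the vector of the \<open>x\<close>-variables is
  \<open>xunit c\<close> times the coordinates of \<open>c\<close>. The substitution imposes this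
  relation and leaves the \<open>y\<close>-variables free.\<close>

definition xsubst :: "(var \<Rightarrow> 'k) \<Rightarrow> var \<Rightarrow> 'k::field bipoly" where
  "xsubst c v = (if v \<in> {X0, X1} then const (c v) * xunit c else Var v)"

text \<open>The same relation imposed on both pairs of variables, that is, reduction modulo both
  linear forms.\<close>

definition point_subst :: "(var \<Rightarrow> 'k) \<Rightarrow> var \<Rightarrow> 'k::field bipoly" where
  "point_subst c v = const (c v) * (if v \<in> {X0, X1} then xunit c else yunit c)"

locale coordinates =
  fixes c :: "var \<Rightarrow> 'k::field"
  assumes x_nonzero: "c X0 \<noteq> 0 \<or> c X1 \<noteq> 0" and y_nonzero: "c Y0 \<noteq> 0 \<or> c Y1 \<noteq> 0"
begin

lemma eval_xunit [simp]: "poly_eval c (xunit c) = 1"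
  using x_nonzero by (auto simp: xunit_def)

lemma eval_yunit [simp]: "poly_eval c (yunit c) = 1"
  using y_nonzero by (auto simp: yunit_def)

lemma xform_nonzero: "xform c \<noteq> 0"
proof
  assume "xform c = 0"
  then have "poly_eval d (xform c) = 0" for d by simp
  \<comment> \<open>The values of \<open>xform c\<close> at these two arguments are
    \<open>c X1\<close> and \<open>- c X0\<close>.\<close>
  from this[of "\<lambda>v. if v = X0 then 1 else 0"] this[of "\<lambda>v. if v = X0 then 0 else 1"] x_nonzero
  show False by (auto simp: poly_eval_xform)
qed

lemma yform_nonzero: "yform c \<noteq> 0"
proof
  assume "yform c = 0"
  then have "poly_eval d (yform c) = 0" for d by simp
  from this[of "\<lambda>v. if v = Y0 then 1 else 0"] this[of "\<lambda>v. if v = Y0 then 0 else 1"] y_nonzero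
  show False by (auto simp: poly_eval_yform)
qed

text \<open>For the variable used in \<open>xunit c\<close> the difference is zero; for the other
  one it is a scalar multiple of \<open>xform c\<close>.\<close>

lemma xform_dvd:
  assumes "v \<in> {X0, X1}"
  shows "xform c dvd Var v - const (c v) * xunit c"
proof (cases "c X0 = 0")
  case True
  then have "xform c = const (c X1) * Var X0" "c X1 \<noteq> 0" using x_nonzero by (auto simp: xform_def)
  then have "Var X0 = const (1 / c X1) * xform c"
    by (simp add: mult.assoc[symmetric] mult_single)
  then show ?thesis
    using assms True x_nonzero by (auto simp: xunit_def const_mult_inverse)
next
  case False
  have "Var X1 - const (c X1) * xunit c = const (- 1 / c X0) * xform c"
    using False by (simp add: xunit_def xform_def right_diff_distrib mult.assoc[symmetric] mult_single
        single_uminus)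
  then show ?thesis
    using assms False by (auto simp: xunit_def const_mult_inverse)
qed

lemma yform_dvd:
  assumes "v \<in> {Y0, Y1}"
  shows "yform c dvd Var v - const (c v) * yunit c"
proof (cases "c Y0 = 0")
  case True
  then have "yform c = const (c Y1) * Var Y0" "c Y1 \<noteq> 0" using y_nonzero by (auto simp: yform_def)
  then have "Var Y0 = const (1 / c Y1) * yform c"
    by (simp add: mult.assoc[symmetric] mult_single)
  then show ?thesis
    using assms True y_nonzero by (auto simp: yunit_def const_mult_inverse)
next
  case False
  have "Var Y1 - const (c Y1) * yunit c = const (- 1 / c Y0) * yform c"
    using False by (simp add: yunit_def yform_def right_diff_distrib mult.assoc[symmetric] mult_single
        single_uminus)
  then show ?thesis
    using assms False by (auto simp: yunit_def const_mult_inverse)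
qed

lemma xform_dvd_subst: "xform c dvd f - eval_with const (xsubst c) f"
proof -
  have "ideal {h. xform c dvd h} polyring" by (rule ideal_class_ringI) auto
  moreover have "Var v - xsubst c v \<in> {h. xform c dvd h}" for v
    using xform_dvd[of v] by (auto simp: xsubst_def)
  ultimately show ?thesis using subst_congruent by blast
qed

text \<open>Substituting \<open>xsubst c\<close> kills exactly the multiples of \<open>xform c\<close> and fixes \<open>yform c\<close>, so
  \<open>yform c\<close> is a nonzerodivisor modulo \<open>xform c\<close>.\<close>

lemma koszul_exact:
  assumes "p * xform c + q * yform c = 0"
  obtains t where "p = t * yform c" "q = - t * xform c"
proof -
  let ?\<phi> = "eval_with const (xsubst c)"
  have "?\<phi> (xform c) = 0"
    by (simp add: xform_def su.eval_diff su.eval_mult xsubst_def mult.left_commute)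
  moreover have "?\<phi> (yform c) = yform c"
    by (simp add: yform_def su.eval_diff su.eval_mult xsubst_def)
  ultimately have "?\<phi> q * yform c = 0"
    using arg_cong[OF assms, of ?\<phi>] by (simp add: su.eval_add su.eval_mult)
  then have "?\<phi> q = 0" using yform_nonzero by simp
  then obtain t where t: "q = t * xform c"
    using xform_dvd_subst[of q] by (auto simp: dvd_def mult.commute)
  then have "(p + t * yform c) * xform c = 0" using assms by (simp add: algebra_simps)
  then have "p = - t * yform c" using xform_nonzero by (simp add: eq_neg_iff_add_eq_0)
  then show ?thesis using that[of "- t"] t by simp
qed

lemma ideal_forms: "ideal {A * xform c + B * yform c | A B. True} polyring"
proof (rule ideal_class_ringI)
  show "0 \<in> {A * xform c + B * yform c | A B. True}"
    by (auto intro!: exI[of _ 0])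
next
  fix a b assume "a \<in> {A * xform c + B * yform c | A B. True}" "b \<in> {A * xform c + B * yform c | A B. True}"
  then obtain A B A' B' where "a = A * xform c + B * yform c" "b = A' * xform c + B' * yform c" by blast
  then have "a + b = (A + A') * xform c + (B + B') * yform c" by (simp add: algebra_simps)
  then show "a + b \<in> {A * xform c + B * yform c | A B. True}" by blast
next
  fix a b assume "a \<in> {A * xform c + B * yform c | A B. True}"
  then obtain A B where "a = A * xform c + B * yform c" by blast
  then have "b * a = (b * A) * xform c + (b * B) * yform c" by (simp add: algebra_simps)
  then show "b * a \<in> {A * xform c + B * yform c | A B. True}" by blast
qed

text \<open>Each variable contributes its coordinate times a unit form, so a monomial of bidegree
  \<open>(i, j)\<close> becomes its value at \<open>c\<close> times one fixed form.\<close>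

lemma point_subst_bihom:
  assumes "bihom (int i, int j) f"
  shows "eval_with const (point_subst c) f = const (poly_eval c f) * (xunit c ^ i * yunit c ^ j)"
  using assms
proof (induction rule: bihom_induct)
  case (single m a)
  let ?l = "Poly_Mapping.lookup m"
  have "i = ?l X0 + ?l X1" "j = ?l Y0 + ?l Y1" using single by (auto simp: bideg_def)
  moreover have "const (b ^ n) = const b ^ n" for b :: 'k and n
    by (induction n) (simp_all add: su.C_mult)
  ultimately show ?case
    by (simp add: su.eval_single ev.eval_single poly_eval_eq UNIV_var point_subst_def
        power_mult_distrib power_add su.C_mult ac_simps)
qed (simp_all add: su.eval_add single_add distrib_right)

text \<open>Modulo the two linear forms each graded piece is spanned by a single form, and the
  coefficient is the value at the point.\<close>

lemma point_reduction:
  assumes "bihom (int i, int j) f"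
  obtains A B where "f = const (poly_eval c f) * (xunit c ^ i * yunit c ^ j) + A * xform c + B * yform c"
proof -
  let ?K = "{A * xform c + B * yform c | A B. True}"
  have "A * xform c \<in> ?K" "B * yform c \<in> ?K" for A B
    by (force intro: exI[of _ 0])+
  then have "Var v - point_subst c v \<in> ?K" for v
    using xform_dvd[of v] yform_dvd[of v] unfolding point_subst_def
    by (cases v) (auto simp: dvd_def mult.commute)
  from subst_congruent[OF ideal_forms this, of f]
  have "f - const (poly_eval c f) * (xunit c ^ i * yunit c ^ j) \<in> ?K"
    unfolding point_subst_bihom[OF assms] .
  then obtain A B where "f - const (poly_eval c f) * (xunit c ^ i * yunit c ^ j) = A * xform c + B * yform c"
    by blast
  then show ?thesis using that[of A B] by (simp add: algebra_simps)
qed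

text \<open>With value zero the leading term of \<open>point_reduction\<close> drops out. The zero
  polynomial is separated off because its \<open>d\<close> may lie outside the quadrant.\<close>

lemma vanishing_in_forms:
  assumes "bihom d f" "poly_eval c f = 0"
  obtains A B where "f = A * xform c + B * yform c"
proof (cases "f = 0")
  case True
  then show ?thesis using that[of 0 0] by simp
next
  case False
  then obtain i j where "d = (int i, int j)" using assms(1) bihom_nonneg by blast
  then obtain A B where "f = const 0 * (xunit c ^ i * yunit c ^ j) + A * xform c + B * yform c"
    using point_reduction[of i j f] assms by metis
  then show ?thesis using that[of A B] by simp
qed

lemma ex_bihom_eval_one: "\<exists>w. bihom (int i, int j) w \<and> poly_eval c w = 1"
proof (intro exI conjI)
  have "bihom ((int i, 0) + (0, int j)) (xunit c ^ i * yunit c ^ j)"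
    using bihom_power[OF bihom_xunit, of i] bihom_power[OF bihom_yunit, of j]
    by (intro bihom_mult) auto
  then show "bihom (int i, int j) (xunit c ^ i * yunit c ^ j)" by simp
qed simp

end

section \<open>Coordinates of points and forms that separate them\<close>

lemma coordinates_coords: "coordinates (coords P)"
proof -
  have nz: "rep_proj1 x \<noteq> (0, 0)" for x :: "'a proj1"
  proof -
    have "proj1_rel (rep_proj1 x) (rep_proj1 x)"
      using Quotient3_rep_reflp[OF Quotient3_proj1] by auto
    then show ?thesis by (simp add: proj1_rel_def)
  qed
  show ?thesis
    using nz[of "fst P"] nz[of "snd P"] by unfold_locales (auto simp: coords_def prod_eq_iff)
qed

text \<open>The premise is the vanishing of a 2 by 2 determinant; the scaling factor is the quotient
  of a pair of nonzero coordinates.\<close>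

lemma proj1_eqI:
  assumes "snd (rep_proj1 p) * fst (rep_proj1 q) = fst (rep_proj1 p) * snd (rep_proj1 q)"
  shows "p = q"
proof -
  have refl: "proj1_rel (rep_proj1 x) (rep_proj1 x)" for x :: "'a proj1"
    using Quotient3_rep_reflp[OF Quotient3_proj1] by auto
  obtain a b where p: "rep_proj1 p = (a, b)" by force
  obtain a' b' where q: "rep_proj1 q = (a', b')" by force
  have nz: "(a, b) \<noteq> (0, 0)" "(a', b') \<noteq> (0, 0)"
    using refl[of p] refl[of q] p q by (auto simp: proj1_rel_def)
  have eq: "b * a' = a * b'" using assms p q by simp
  have "\<exists>t. t \<noteq> 0 \<and> (a', b') = (t * a, t * b)"
  proof (cases "a = 0")
    case True
    then have "b \<noteq> 0" "a' = 0" "b' \<noteq> 0" using nz eq by auto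
    then show ?thesis using True by (intro exI[of _ "b' / b"]) simp
  next
    case False
    then have "a' \<noteq> 0" using nz eq by auto
    then show ?thesis using False eq by (intro exI[of _ "a' / a"]) (simp add: field_simps)
  qed
  then have "proj1_rel (rep_proj1 p) (rep_proj1 q)"
    using nz p q by (simp add: proj1_rel_def)
  then show ?thesis
    using Quotient3_rel_rep[OF Quotient3_proj1] by blast
qed

text \<open>Distinct points differ in one of the two factors, and the linear form belonging to that
  factor is nonzero at the other point.\<close>

lemma forms_separate:
  assumes "P \<noteq> P'"
  shows "value_at (xform (coords P)) P' \<noteq> 0 \<or> value_at (yform (coords P)) P' \<noteq> 0"
  using assms proj1_eqI[of "fst P" "fst P'"] proj1_eqI[of "snd P" "snd P'"]
  by (auto simp: value_at_def poly_eval_xform poly_eval_yform coords_def prod_eq_iff)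

lemma ideal_vanishing: "ideal {f. value_at f P = 0} polyring"
  by (rule ideal_class_ringI) (auto simp: value_at_def)

text \<open>The polynomials vanishing at the chosen coordinates form an ideal containing all
  generators of \<open>point_ideal P\<close>.\<close>

lemma value_at_point_ideal: "f \<in> point_ideal P \<Longrightarrow> value_at f P = 0"
  using genideal_least[OF ideal_vanishing, of "{f. (\<exists>d. bihom d f) \<and> value_at f P = 0}" P]
  unfolding point_ideal_def by blast

section \<open>Points of multiplicity one\<close>

text \<open>For the ideals \<open>S\<close>, \<open>I\<close>, and the vanishing ideal of \<open>P\<close> this is the local ring at \<open>P\<close>, the
  stalk of \<open>I\<close>, and the maximal ideal.\<close>

definition homogeneous_fractions :: "'k::field point \<Rightarrow> 'k bipoly set \<Rightarrow> 'k bipoly fract set" where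
  "homogeneous_fractions P K =
     {Fract f g | f g. f \<in> K \<and> value_at g P \<noteq> 0 \<and> (\<exists>d. bihom d f \<and> bihom d g)}"

lemma homogeneous_fractionsE:
  assumes "x \<in> homogeneous_fractions P K"
  obtains f g d where "x = Fract f g" "f \<in> K" "value_at g P \<noteq> 0" "bihom d f" "bihom d g" "g \<noteq> 0"
  using assms unfolding homogeneous_fractions_def value_at_def by fastforce

lemma homogeneous_fractionsI:
  "f \<in> K \<Longrightarrow> value_at g P \<noteq> 0 \<Longrightarrow> bihom d f \<Longrightarrow> bihom d g \<Longrightarrow> Fract f g \<in> homogeneous_fractions P K"
  unfolding homogeneous_fractions_def by blast

lemma homogeneous_fractions_add:
  assumes "ideal K polyring" "x \<in> homogeneous_fractions P K" "y \<in> homogeneous_fractions P K"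
  shows "x + y \<in> homogeneous_fractions P K"
proof -
  note ID = ideal_class_ringD[OF assms(1)]
  obtain f g d where x: "x = Fract f g" "f \<in> K" "value_at g P \<noteq> 0" "bihom d f" "bihom d g" "g \<noteq> 0"
    using assms(2) by (rule homogeneous_fractionsE)
  obtain f' g' d' where y: "y = Fract f' g'" "f' \<in> K" "value_at g' P \<noteq> 0" "bihom d' f'" "bihom d' g'" "g' \<noteq> 0"
    using assms(3) by (rule homogeneous_fractionsE)
  have "bihom (d + d') (f * g' + f' * g)"
    using bihom_mult[OF x(4) y(5)] bihom_mult[OF y(4) x(5)] by (intro bihom_add) (simp_all add: add.commute)
  then show ?thesis
    using x y bihom_mult[OF x(5) y(5)]
    by (auto simp: value_at_def intro!: homogeneous_fractionsI[where d = "d + d'"] ID)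
qed

lemma homogeneous_fractions_mult:
  assumes "ideal K polyring" "x \<in> homogeneous_fractions P UNIV" "y \<in> homogeneous_fractions P K"
  shows "x * y \<in> homogeneous_fractions P K"
proof -
  note ID = ideal_class_ringD[OF assms(1)]
  obtain f g d where x: "x = Fract f g" "value_at g P \<noteq> 0" "bihom d f" "bihom d g" "g \<noteq> 0"
    using assms(2) by (rule homogeneous_fractionsE)
  obtain f' g' d' where y: "y = Fract f' g'" "f' \<in> K" "value_at g' P \<noteq> 0" "bihom d' f'" "bihom d' g'" "g' \<noteq> 0"
    using assms(3) by (rule homogeneous_fractionsE)
  show ?thesis
    using x y bihom_mult[OF x(3) y(4)] bihom_mult[OF x(4) y(5)]
    by (auto simp: value_at_def intro!: homogeneous_fractionsI[where d = "d + d'"] ID(3))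
qed

lemma const_fraction: "Fract (const a) 1 \<in> homogeneous_fractions P UNIV"
  by (rule homogeneous_fractionsI[OF _ _ bihom_const])
     (use bihom_const[of 1] in \<open>auto simp: value_at_def\<close>)

lemma homogeneous_fractions_uminus:
  assumes "ideal K polyring" "x \<in> homogeneous_fractions P K"
  shows "- x \<in> homogeneous_fractions P K"
proof -
  have "Fract (const (- 1)) 1 = - (1 :: 'a bipoly fract)"
    by (simp add: single_uminus One_fract_def)
  then show ?thesis
    using homogeneous_fractions_mult[OF assms(1) const_fraction[of "- 1"] assms(2)] by simp
qed

lemma local_ring_carrier: "local_ring P = class_ring\<lparr>carrier := homogeneous_fractions P UNIV\<rparr>"
  by (simp add: local_ring_def homogeneous_fractions_def)

lemma ideal_UNIV: "ideal UNIV (class_ring :: 'a::comm_ring_1 ring)"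
  by (rule ideal_class_ringI) auto

lemma ring_local_ring: "ring (local_ring P)"
  unfolding local_ring_carrier
proof (rule ring.subring_is_ring[OF class_ring.ring_axioms], rule ring.subringI[OF class_ring.ring_axioms])
  show "\<one>\<^bsub>class_ring\<^esub> \<in> homogeneous_fractions P UNIV"
    using const_fraction[of 1 P] by (simp add: class_ring_simps One_fract_def)
qed (auto simp: class_ring_simps intro: homogeneous_fractions_add homogeneous_fractions_mult
      homogeneous_fractions_uminus ideal_UNIV)

lemma ideal_homogeneous_fractions:
  assumes K: "ideal K polyring"
  shows "ideal (homogeneous_fractions P K) (local_ring P)"
proof (rule idealI[OF ring_local_ring])
  interpret L: ring "local_ring P" by (rule ring_local_ring)
  have sub: "homogeneous_fractions P K \<subseteq> homogeneous_fractions P UNIV"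
    by (auto simp: homogeneous_fractions_def)
  have carrier: "carrier (local_ring P) = homogeneous_fractions P UNIV"
    and add: "x \<oplus>\<^bsub>local_ring P\<^esub> y = x + y" and mult: "x \<otimes>\<^bsub>local_ring P\<^esub> y = x * y"
    and zero: "\<zero>\<^bsub>local_ring P\<^esub> = 0" for x y
    by (simp_all add: local_ring_carrier class_ring_simps)
  have inv: "inv\<^bsub>add_monoid (local_ring P)\<^esub> x = - x" if "x \<in> homogeneous_fractions P K" for x
  proof -
    have "x \<in> homogeneous_fractions P UNIV" "- x \<in> homogeneous_fractions P UNIV"
      using that sub homogeneous_fractions_uminus[OF K that] by auto
    then have "\<ominus>\<^bsub>local_ring P\<^esub> x = - x"
      by (intro L.minus_equality) (simp_all add: carrier add zero)
    then show ?thesis by (simp add: a_inv_def)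
  qed
  have "Fract 0 1 \<in> homogeneous_fractions P K"
    by (rule homogeneous_fractionsI[of _ _ _ _ "(0, 0)"])
       (use bihom_const[of 1] ideal_class_ringD(1)[OF K] in \<open>auto simp: value_at_def\<close>)
  then have zero_in: "0 \<in> homogeneous_fractions P K" by (simp add: Zero_fract_def)
  show "subgroup (homogeneous_fractions P K) (add_monoid (local_ring P))"
  proof (rule subgroup.intro)
    fix x assume x: "x \<in> homogeneous_fractions P K"
    then show "inv\<^bsub>add_monoid (local_ring P)\<^esub> x \<in> homogeneous_fractions P K"
      unfolding inv[OF x] by (rule homogeneous_fractions_uminus[OF K])
  qed (use sub zero_in homogeneous_fractions_add[OF K] in \<open>auto simp: carrier add zero\<close>)
  fix a x assume "a \<in> homogeneous_fractions P K" "x \<in> carrier (local_ring P)"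
  then show "x \<otimes>\<^bsub>local_ring P\<^esub> a \<in> homogeneous_fractions P K"
    "a \<otimes>\<^bsub>local_ring P\<^esub> x \<in> homogeneous_fractions P K"
    using homogeneous_fractions_mult[OF K, of x P a] by (simp_all add: carrier mult mult.commute[of a])
qed

text \<open>The correspondence theorem turns \<open>N\<close>, \<open>M\<close> and the whole ring
  into a strict chain of ideals of the quotient; length counts its two inclusions.\<close>

lemma two_le_length_quotient:
  assumes "ring R" "ideal N R" "ideal M R" "N \<subset> M" "M \<subset> carrier R"
  shows "2 \<le> ring_length (R Quot N)"
proof -
  interpret ring R by fact
  have L: "ideal (carrier R) R" by (rule oneideal)
  define h where "h = (\<lambda>J. (+>\<^bsub>R\<^esub>) N ` J)"
  have bij: "bij_betw h {J. ideal J R \<and> N \<subseteq> J} {J. ideal J (R Quot N)}"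
    unfolding h_def by (rule quot_ideal_correspondence[OF assms(2)])
  have h: "ideal (h N) (R Quot N)" "ideal (h M) (R Quot N)" "ideal (h (carrier R)) (R Quot N)"
    using assms L bij_betwE[OF bij] by auto
  have "h N \<noteq> h M" "h M \<noteq> h (carrier R)"
    using bij_betw_imp_inj_on[OF bij] assms L unfolding inj_on_def by blast+
  moreover have "h N \<subseteq> h M" "h M \<subseteq> h (carrier R)"
    using assms(4,5) by (auto simp: h_def)
  ultimately have strict: "h N \<subset> h M" "h M \<subset> h (carrier R)" by auto
  \<comment> \<open>Three ideals at the indices 0, 1, 2; the values beyond index 2 are irrelevant to
    the chain.\<close>
  define A where "A = (\<lambda>i::nat. if i = 0 then h N else if i = 1 then h M else h (carrier R))"
  have "(\<forall>i \<le> 2. ideal (A i) (R Quot N)) \<and> (\<forall>i < 2. A i \<subset> A (Suc i))"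
    using h strict by (auto simp: A_def less_2_cases_iff)
  then have "enat 2 \<le> ring_length (R Quot N)"
    unfolding ring_length_def by (intro Sup_upper) blast
  then show ?thesis by (simp add: numeral_eq_enat)
qed

text \<open>Multiplicity one forces the stalk of \<open>I\<close> to be the whole maximal ideal.
  Clearing denominators in the local ring then brings \<open>f\<close> into \<open>I\<close> up to a
  factor that is nonzero at \<open>P\<close>.\<close>

lemma multiplicity_one:
  assumes I: "ideal I polyring" and P: "P \<in> support I" and mult: "multiplicity_at I P = 1"
    and f: "bihom d f" "value_at f P = 0"
  shows "\<exists>g. value_at g P \<noteq> 0 \<and> f * g \<in> I"
proof -
  note ID = ideal_class_ringD[OF I]
  let ?V = "{f. value_at f P = 0}"
  let ?N = "homogeneous_fractions P I" and ?M = "homogeneous_fractions P ?V"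
  have "?N \<subseteq> ?M"
    using P unfolding support_def homogeneous_fractions_def by blast
  moreover have "?M \<subset> carrier (local_ring P)"
  proof -
    have "1 \<notin> ?M"
    proof
      assume "1 \<in> ?M"
      then obtain f g where "1 = Fract f g" "f \<in> ?V" "value_at g P \<noteq> 0" "g \<noteq> 0"
        by (rule homogeneous_fractionsE)
      then show False by (simp add: One_fract_def eq_fract)
    qed
    moreover have "1 \<in> homogeneous_fractions P UNIV"
      using const_fraction[of 1 P] by (simp add: One_fract_def)
    moreover have "?M \<subseteq> homogeneous_fractions P UNIV"
      by (auto simp: homogeneous_fractions_def)
    ultimately show ?thesis by (auto simp: local_ring_carrier)
  qed
  moreover have "ideal_stalk I P = ?N"
    by (simp add: ideal_stalk_def homogeneous_fractions_def)
  then have "\<not> 2 \<le> ring_length (local_ring P Quot ?N)"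
    using mult by (simp add: multiplicity_at_def)
  \<comment> \<open>Were the inclusion of \<open>?N\<close> in \<open>?M\<close> strict,
    \<open>?N\<close>, \<open>?M\<close> and the local ring would give length at least two.\<close>
  ultimately have eq: "?M = ?N"
    using two_le_length_quotient[OF ring_local_ring ideal_homogeneous_fractions[OF I]
        ideal_homogeneous_fractions[OF ideal_vanishing]] by blast
  show ?thesis
  proof (cases "f = 0")
    \<comment> \<open>The zero polynomial has every bidegree, also those without any form that could
      serve as denominator.\<close>
    case True
    then show ?thesis using ID(1) by (intro exI[of _ 1]) (simp add: value_at_def)
  next
    case False
    then obtain i j where d: "d = (int i, int j)" using f bihom_nonneg by blast
    \<comment> \<open>Dividing by a form of the same bidegree that is nonzero at \<open>P\<close>
      places \<open>f\<close> in the local ring.\<close>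
    obtain w where w: "bihom d w" "value_at w P = 1"
      using coordinates.ex_bihom_eval_one[OF coordinates_coords, of i j P] d by (auto simp: value_at_def)
    then have "Fract f w \<in> ?N" using f eq homogeneous_fractionsI[of f ?V w P d] by auto
    then obtain f' g where g: "Fract f w = Fract f' g" "f' \<in> I" "value_at g P \<noteq> 0" "g \<noteq> 0"
      by (rule homogeneous_fractionsE)
    moreover have "w \<noteq> 0" using w(2) by (auto simp: value_at_def)
    ultimately have "f * g = f' * w" by (simp add: eq_fract)
    then show ?thesis using g ID(4) by metis
  qed
qed

section \<open>The ideal of the residual scheme\<close>

text \<open>Descent on the total degree. It terminates because separators are nonzero, so their
  bidegrees stay in the quadrant.\<close>

lemma ex_minimal_separating_degree_le:
  assumes "separator I J P e g"
  shows "\<exists>d \<le> e. minimal_separating_degree I J P d"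
  using assms
proof (induction "nat (fst e + snd e)" arbitrary: e g rule: less_induct)
  case less
  show ?case
  proof (cases "minimal_separating_degree I J P e")
    case False
    then obtain e' g' where e': "separator I J P e' g'" "e' < e"
      using less.prems unfolding minimal_separating_degree_def by blast
    have "g \<noteq> 0" "g' \<noteq> 0" and "bihom e g" "bihom e' g'"
      using less.prems e'(1) by (auto simp: separator_def value_at_def)
    then obtain i j i' j' where "e = (int i, int j)" "e' = (int i', int j')"
      using bihom_nonneg by metis
    then have "nat (fst e' + snd e') < nat (fst e + snd e)"
      using e'(2) by (auto simp: less_prod_def less_eq_prod_def)
    then show ?thesis
      using less.hyps e' by (meson less_imp_le order_trans)
  qed blast
qed

text \<open>Collects what the mapping cone needs: the quotient of the residual ideal by
  \<open>I\<close> is cyclic, generated by a separator, and its annihilator is the ideal of the two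
  linear forms.\<close>

lemma remove_point_generated:
  fixes I :: "'k::field bipoly set"
  assumes zero_dim: "zero_dim_scheme I" and dec: "point_decomposition I J"
    and P: "P \<in> support I" and mult: "multiplicity_at I P = 1"
    and deg: "{d. minimal_separating_degree I J P d} = {(int r, int s)}"
  obtains f where "bihom (int r, int s) f"
    and "remove_point I J P = {h + g * f | h g. h \<in> I}"
    and "xform (coords P) * f \<in> I" and "yform (coords P) * f \<in> I"
    and "\<forall>g. g * f \<in> I \<longrightarrow> (\<exists>A B. g = A * xform (coords P) + B * yform (coords P))"
proof -
  interpret coordinates "coords P" by (rule coordinates_coords)
  let ?l = "xform (coords P)" and ?m = "yform (coords P)" and ?Z = "remove_point I J P"
  have hom: "bihom_ideal I" using zero_dim by (simp add: zero_dim_scheme_def)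
  then have I: "ideal I polyring" by (simp add: bihom_ideal_def)
  note ID = ideal_class_ringD[OF I]
  have I_eq: "I = (\<Inter>P \<in> support I. J P)"
    and primary: "\<And>P'. P' \<in> support I \<Longrightarrow> primary (J P')"
    and radical: "\<And>P'. P' \<in> support I \<Longrightarrow> radical (J P') = point_ideal P'"
    using dec by (auto simp: point_decomposition_def)
  have ideal_J: "ideal (J P') polyring" if "P' \<in> support I" for P'
    using primary[OF that] by (simp add: primary_def)
  \<comment> \<open>In a primary ideal whose radical is the point ideal, a factor that is nonzero at
    the point can be cancelled.\<close>
  have cancel: "g \<in> J P'" if "P' \<in> support I" "g * h \<in> J P'" "value_at h P' \<noteq> 0" for P' g h
  proof -
    have "h \<notin> radical (J P')"
      using that(3) value_at_point_ideal radical[OF that(1)] by blast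
    then show ?thesis using primary[OF that(1)] that(2) unfolding primary_def by blast
  qed
  have J_vanish: "value_at g P = 0" if "g \<in> J P" for g
  proof -
    have "g ^ 1 \<in> J P" using that by simp
    then have "g \<in> radical (J P)" unfolding radical_def by blast
    then show ?thesis using value_at_point_ideal radical[OF P] by blast
  qed
  \<comment> \<open>Multiplicity one enters here: the factor supplied by
    \<open>multiplicity_one\<close> is cancelled in \<open>J P\<close>.\<close>
  have in_J: "g \<in> J P" if g: "bihom d g" "value_at g P = 0" for g d
  proof -
    obtain h where "value_at h P \<noteq> 0" "g * h \<in> I" using multiplicity_one[OF I P mult g] by blast
    then show ?thesis using cancel[OF P] I_eq P by blast
  qed
  have l: "?l \<in> J P" and m: "?m \<in> J P"
    using in_J[OF bihom_xform] in_J[OF bihom_yform]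
    by (simp_all add: value_at_def poly_eval_xform poly_eval_yform mult.commute)
  have I_Z: "g \<in> I \<longleftrightarrow> g \<in> ?Z \<and> g \<in> J P" for g
    using P by (subst I_eq) (auto simp: remove_point_def)
  have ideal_Z: "ideal ?Z polyring"
    by (rule ideal_class_ringI) (auto simp: remove_point_def dest: ideal_class_ringD[OF ideal_J])
  note ZD = ideal_class_ringD[OF ideal_Z]
  note JD = ideal_class_ringD[OF ideal_J[OF P]]
  have Z_mult: "?l * g \<in> I" "?m * g \<in> I" if "g \<in> ?Z" for g
    using that l m ZD JD by (auto simp: I_Z)
  \<comment> \<open>At every other point of the support one of the two forms is nonzero and cancels.
    Together with \<open>Z_mult\<close> this describes the residual ideal as a colon ideal of
    \<open>I\<close>.\<close>
  have ZI: "g \<in> ?Z" if "?l * g \<in> I" "?m * g \<in> I" for g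
    unfolding remove_point_def
  proof
    fix P' assume P': "P' \<in> support I - {P}"
    have "g * ?l \<in> J P'" "g * ?m \<in> J P'"
      using that I_eq P' by (auto simp: mult.commute)
    then show "g \<in> J P'"
      using forms_separate[of P P'] cancel P' by blast
  qed
  \<comment> \<open>\<open>point_decomposition\<close> does not state that the \<open>J P'\<close>
    are bihomogeneous, so homogeneity is carried over from \<open>I\<close> through the colon
    description.\<close>
  have Z_hcomp: "hcomp e g \<in> ?Z" if "g \<in> ?Z" for e g
  proof (rule ZI)
    show "?l * hcomp e g \<in> I"
      using bihom_ideal_hcomp[OF hom Z_mult(1)[OF that]] hcomp_mult[OF bihom_xform] by metis
    show "?m * hcomp e g \<in> I"
      using bihom_ideal_hcomp[OF hom Z_mult(2)[OF that]] hcomp_mult[OF bihom_yform] by metis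
  qed
  have "minimal_separating_degree I J P (int r, int s)" using deg by auto
  then obtain f where f: "bihom (int r, int s) f" "value_at f P \<noteq> 0" "f \<in> ?Z"
    unfolding minimal_separating_degree_def separator_def by blast
  let ?F = "{h + g * f | h g. h \<in> I}"
  have F: "ideal ?F polyring"
  proof (rule ideal_class_ringI)
    have "0 = 0 + 0 * f" by simp
    then show "0 \<in> ?F" using ID(1) by blast
  next
    fix a b assume "a \<in> ?F" "b \<in> ?F"
    then obtain h g h' g' where "a = h + g * f" "b = h' + g' * f" "h \<in> I" "h' \<in> I" by blast
    then have "a + b = (h + h') + (g + g') * f" "h + h' \<in> I" using ID by (auto simp: algebra_simps)
    then show "a + b \<in> ?F" by blast
  next
    fix a b assume "a \<in> ?F"
    then obtain h g where "a = h + g * f" "h \<in> I" by blast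
    then have "b * a = b * h + (b * g) * f" by (simp add: algebra_simps)
    moreover have "b * h \<in> I" by (rule ID(3)) fact
    ultimately show "b * a \<in> ?F" by blast
  qed
  \<comment> \<open>A form vanishing at \<open>P\<close> is already in \<open>I\<close>; any other
    one is a separator and is corrected by a multiple of \<open>f\<close>.\<close>
  have hom_F: "g \<in> ?F" if g: "bihom e g" "g \<in> ?Z" for e g
  proof (cases "value_at g P = 0")
    case True
    then have "g \<in> I" using in_J[OF g(1)] g(2) I_Z by blast
    moreover have "g = g + 0 * f" by simp
    ultimately show ?thesis by blast
  next
    case False
    then have "separator I J P e g" using g by (simp add: separator_def)
    \<comment> \<open>Uniqueness of the minimal separating degree makes \<open>d\<close> equal to
      \<open>(r, s)\<close>, so the degree of the cofactor of \<open>f\<close> is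
      nonnegative.\<close>
    then obtain d where d: "d \<le> e" "minimal_separating_degree I J P d"
      using ex_minimal_separating_degree_le by blast
    then have "d = (int r, int s)" using deg by blast
    then have le: "(int r, int s) \<le> e" using d(1) by simp
    have "g \<noteq> 0" using False by (auto simp: value_at_def)
    then obtain i j where e: "e = (int i, int j)" using g(1) bihom_nonneg by blast
    then have rs: "r \<le> i" "s \<le> j" using le by (auto simp: less_eq_prod_def)
    obtain w where w: "bihom (int (i - r), int (j - s)) w" "value_at w P = 1"
      using ex_bihom_eval_one unfolding value_at_def by blast
    \<comment> \<open>Scaled so that \<open>q * f\<close> and \<open>g\<close> have the same value
      at \<open>P\<close>.\<close>
    define q where "q = const (value_at g P / value_at f P) * w"
    have "bihom ((int (i - r), int (j - s)) + (int r, int s)) (q * f)"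
      unfolding q_def by (intro bihom_mult bihom_const_mult w f)
    then have "bihom e (g - q * f)" using rs e g(1) by (intro bihom_diff) (auto simp: of_nat_diff)
    moreover have "value_at (g - q * f) P = 0"
      using f(2) w(2) by (simp add: q_def value_at_def)
    ultimately have "g - q * f \<in> J P" by (rule in_J)
    moreover have "g - q * f \<in> ?Z" using g(2) f(3) ZD by auto
    ultimately have "g - q * f \<in> I" using I_Z by blast
    moreover have "g = (g - q * f) + q * f" by simp
    ultimately show ?thesis by blast
  qed
  have "?Z = ?F"
  proof
    show "?Z \<subseteq> ?F"
    proof
      fix g assume "g \<in> ?Z"
      then have "(\<Sum>d\<in>bideg ` Poly_Mapping.keys g. hcomp d g) \<in> ?F"
        by (intro ideal_sum[OF F] hom_F[OF bihom_hcomp] Z_hcomp)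
      then show "g \<in> ?F" by (simp only: sum_hcomp)
    qed
    show "?F \<subseteq> ?Z" using I_Z f(3) ZD(2,3) by blast
  qed
  \<comment> \<open>Since \<open>f\<close> is nonzero at \<open>P\<close>, each component of
    \<open>g\<close> vanishes there and so lies in the ideal of the two forms.\<close>
  moreover have "\<exists>A B. g = A * ?l + B * ?m" if "g * f \<in> I" for g
  proof -
    let ?K = "{A * ?l + B * ?m | A B. True}"
    have "hcomp e g \<in> ?K" for e
    proof -
      have "hcomp e g * f \<in> I"
        using bihom_ideal_hcomp[OF hom that] hcomp_mult[OF f(1)] by (metis mult.commute)
      then have "value_at (hcomp e g * f) P = 0" using J_vanish I_Z by blast
      then have "poly_eval (coords P) (hcomp e g) = 0" using f(2) by (simp add: value_at_def)
      then show ?thesis using vanishing_in_forms[OF bihom_hcomp] by blast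
    qed
    then have "(\<Sum>d\<in>bideg ` Poly_Mapping.keys g. hcomp d g) \<in> ?K" by (intro ideal_sum[OF ideal_forms])
    then show ?thesis by (simp add: sum_hcomp)
  qed
  ultimately show ?thesis using that[OF f(1)] Z_mult[OF f(3)] by blast
qed

section \<open>Graded maps and block matrices\<close>

lemma graded_map_carrier: "graded_map b a A \<Longrightarrow> A \<in> carrier_mat (length a) (length b)"
  by (simp add: graded_map_def)

lemma graded_mapD:
  "graded_map b a A \<Longrightarrow> i < length a \<Longrightarrow> j < length b \<Longrightarrow> bihom (b ! j - a ! i) (A $$ (i, j))"
  by (simp add: graded_map_def)

lemma bihom_sum: "(\<And>i. i \<in> X \<Longrightarrow> bihom d (f i)) \<Longrightarrow> bihom d (\<Sum>i\<in>X. f i)"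
  by (induction X rule: infinite_finite_induct) (auto intro: bihom_add)

lemma graded_map_mult:
  assumes A: "graded_map b a A" and B: "graded_map c b B"
  shows "graded_map c a (A * B)"
  unfolding graded_map_def
proof (intro conjI allI impI)
  note car = graded_map_carrier[OF A] graded_map_carrier[OF B]
  show "A * B \<in> carrier_mat (length a) (length c)" using car by auto
  fix i j assume ij: "i < length a" "j < length c"
  have "bihom (c ! j - a ! i) (A $$ (i, k) * B $$ (k, j))" if "k < length b" for k
    using bihom_mult[OF graded_mapD[OF A ij(1) that] graded_mapD[OF B that ij(2)]]
    by simp
  then show "bihom (c ! j - a ! i) ((A * B) $$ (i, j))"
    using car ij by (auto simp: scalar_prod_def intro!: bihom_sum)
qed

lemma graded_map_uminus: "graded_map b a A \<Longrightarrow> graded_map b a (- A)"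
  by (auto simp: graded_map_def intro!: bihom_uminus)

lemma graded_map_block:
  assumes A: "graded_map b a A" and C: "graded_map b' a C" and F: "graded_map b' a' F"
  shows "graded_map (b @ b') (a @ a') (four_block_mat A C (0\<^sub>m (length a') (length b)) F)"
  using graded_map_carrier[OF A] graded_map_carrier[OF C] graded_map_carrier[OF F]
  by (auto simp: graded_map_def nth_append
      intro!: graded_mapD[OF A] graded_mapD[OF C] graded_mapD[OF F] split: if_splits)

text \<open>An entry has degree \<open>b ! j - a ! i\<close>, which the premise keeps away from
  zero.\<close>

lemma elements_in_variables_ideal:
  assumes A: "graded_map b a A" and "\<And>i j. i < length a \<Longrightarrow> j < length b \<Longrightarrow> b ! j \<noteq> a ! i"
  shows "elements_mat A \<subseteq> variables_ideal"
proof
  fix x assume "x \<in> elements_mat A"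
  then obtain i j where "i < length a" "j < length b" "x = A $$ (i, j)"
    using graded_map_carrier[OF A] by auto
  then show "x \<in> variables_ideal"
    using assms(2)[of i j] graded_mapD[OF A, of i j] bihom_in_variables_ideal[of "b ! j - a ! i" x]
    by (simp add: zero_prod_def[symmetric])
qed

section \<open>Lifting along graded maps\<close>

lemma mat_imageI: "A \<in> carrier_mat m n \<Longrightarrow> v \<in> carrier_vec n \<Longrightarrow> A *\<^sub>v v \<in> mat_image A"
  by (auto simp: mat_image_def)

lemma mat_imageE:
  assumes "z \<in> mat_image A" "A \<in> carrier_mat m n"
  obtains v where "v \<in> carrier_vec n" "z = A *\<^sub>v v"
  using assms by (auto simp: mat_image_def)

text \<open>Any preimage can be replaced by its components in the degrees that the grading
  prescribes: the entries of \<open>A\<close> are forms, so \<open>A\<close> respects this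
  projection, and \<open>z\<close> is fixed by it.\<close>

lemma graded_lift_vec:
  assumes A: "graded_map b a A" and z: "z \<in> mat_image A"
    and hom: "\<And>i. i < length a \<Longrightarrow> bihom (d - a ! i) (z $ i)"
  shows "\<exists>w \<in> carrier_vec (length b). A *\<^sub>v w = z \<and> (\<forall>j < length b. bihom (d - b ! j) (w $ j))"
proof -
  note car = graded_map_carrier[OF A]
  obtain v where v: "v \<in> carrier_vec (length b)" "z = A *\<^sub>v v" using mat_imageE[OF z car] by blast
  define w where "w = vec (length b) (\<lambda>j. hcomp (d - b ! j) (v $ j))"
  have "(A *\<^sub>v w) $ i = z $ i" if i: "i < length a" for i
  proof -
    have "z $ i = hcomp (d - a ! i) (z $ i)" using hcomp_same[OF hom[OF i]] by simp
    also have "\<dots> = (\<Sum>j<length b. hcomp (d - a ! i) (A $$ (i, j) * v $ j))"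
      using v car i by (simp add: scalar_prod_def hcomp_sum atLeast0LessThan)
    also have "\<dots> = (\<Sum>j<length b. A $$ (i, j) * w $ j)"
    proof (rule sum.cong[OF refl])
      fix j assume "j \<in> {..<length b}"
      then show "hcomp (d - a ! i) (A $$ (i, j) * v $ j) = A $$ (i, j) * w $ j"
        using hcomp_mult[OF graded_mapD[OF A i, of j], of "d - b ! j" "v $ j"] by (simp add: w_def)
    qed
    also have "\<dots> = (A *\<^sub>v w) $ i"
      using car i by (simp add: scalar_prod_def w_def atLeast0LessThan)
    finally show ?thesis ..
  qed
  then have "A *\<^sub>v w = z" using v car by (intro eq_vecI) auto
  then show ?thesis by (intro bexI[of _ w]) (auto simp: w_def bihom_hcomp)
qed

text \<open>Graded free modules are projective: each column of \<open>Z\<close> is lifted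
  homogeneously.\<close>

lemma graded_lift_mat:
  assumes A: "graded_map b a A" and Z: "graded_map d a Z"
    and im: "\<And>j. j < length d \<Longrightarrow> col Z j \<in> mat_image A"
  obtains C where "graded_map d b C" "A * C = Z"
proof -
  note car = graded_map_carrier[OF A] graded_map_carrier[OF Z]
  have "\<exists>w \<in> carrier_vec (length b). A *\<^sub>v w = col Z j \<and> (\<forall>i < length b. bihom (d ! j - b ! i) (w $ i))"
    if "j < length d" for j
    using graded_lift_vec[OF A im[OF that], of "d ! j"] graded_mapD[OF Z _ that] car that by auto
  then obtain w where w: "\<And>j. j < length d \<Longrightarrow> w j \<in> carrier_vec (length b)"
    "\<And>j. j < length d \<Longrightarrow> A *\<^sub>v w j = col Z j"
    "\<And>j i. j < length d \<Longrightarrow> i < length b \<Longrightarrow> bihom (d ! j - b ! i) (w j $ i)"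
    by metis
  define C where "C = mat (length b) (length d) (\<lambda>(i, j). w j $ i)"
  have col: "col C j = w j" if "j < length d" for j
    using w(1)[OF that] that by (intro eq_vecI) (auto simp: C_def)
  have C: "C \<in> carrier_mat (length b) (length d)" by (simp add: C_def)
  have "col (A * C) j = col Z j" if "j < length d" for j
    unfolding col_mult2[OF car(1) C that] col[OF that] w(2)[OF that] ..
  then have "A * C = Z" using car by (intro mat_col_eqI) (auto simp: C_def)
  moreover have "graded_map d b C" using w(3) by (auto simp: graded_map_def C_def)
  ultimately show ?thesis using that by blast
qed

section \<open>Kernels and images of block triangular matrices\<close>

lemma split_vec:
  assumes "v \<in> carrier_vec (m + n)"
  obtains x y where "v = x @\<^sub>v y" "x \<in> carrier_vec m" "y \<in> carrier_vec n"
  using vec_first_last_append[OF assms] by (metis vec_first_carrier vec_last_carrier)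

lemma zero_append_vec: "0\<^sub>v (m + n) = 0\<^sub>v m @\<^sub>v 0\<^sub>v n"
  by (intro eq_vecI) auto

lemma block_mult_vec:
  fixes A :: "'a::comm_ring_1 mat"
  assumes "A \<in> carrier_mat m n" "C \<in> carrier_mat m q" "F \<in> carrier_mat p q"
    and "x \<in> carrier_vec n" "y \<in> carrier_vec q"
  shows "four_block_mat A C (0\<^sub>m p n) F *\<^sub>v (x @\<^sub>v y) = (A *\<^sub>v x + C *\<^sub>v y) @\<^sub>v (F *\<^sub>v y)"
  using assms by (subst four_block_mat_mult_vec) auto

lemma block_mult_vec_eq_zero_iff:
  fixes A :: "'a::comm_ring_1 mat"
  assumes "A \<in> carrier_mat m n" "C \<in> carrier_mat m q" "F \<in> carrier_mat p q"
    and "x \<in> carrier_vec n" "y \<in> carrier_vec q"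
  shows "four_block_mat A C (0\<^sub>m p n) F *\<^sub>v (x @\<^sub>v y) = 0\<^sub>v (m + p) \<longleftrightarrow>
    A *\<^sub>v x + C *\<^sub>v y = 0\<^sub>v m \<and> F *\<^sub>v y = 0\<^sub>v p"
  using assms unfolding block_mult_vec[OF assms] zero_append_vec
  by (intro append_vec_eq[of _ m]) auto

text \<open>One exactness step of a mapping cone. \<open>AC\<close> makes the off-diagonal block of
  the composite zero. The premise \<open>lift\<close> covers two uses: exactness of the Koszul
  complex in the middle, and the colon condition at the end of the cone, where
  \<open>p = 0\<close>.\<close>

lemma block_exact:
  fixes A :: "'k::field bipoly mat"
  assumes A: "A \<in> carrier_mat m n" and A': "A' \<in> carrier_mat n l"
    and C: "C \<in> carrier_mat m q" and C': "C' \<in> carrier_mat n h"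
    and F: "F \<in> carrier_mat p q" and F': "F' \<in> carrier_mat q h"
    and exact: "mat_kernel A = mat_image A'"
    and FF': "F * F' = 0\<^sub>m p h" and AC: "A * C' = - (C * F')"
    and lift: "\<And>y. y \<in> carrier_vec q \<Longrightarrow> F *\<^sub>v y = 0\<^sub>v p \<Longrightarrow> C *\<^sub>v y \<in> mat_image A \<Longrightarrow> y \<in> mat_image F'"
  shows "mat_kernel (four_block_mat A C (0\<^sub>m p n) F) = mat_image (four_block_mat A' C' (0\<^sub>m q l) F')"
    (is "mat_kernel ?B = mat_image ?B'")
proof
  have B: "?B \<in> carrier_mat (m + p) (n + q)" and B': "?B' \<in> carrier_mat (n + q) (l + h)"
    using A C F A' C' F' by auto
  have AC_vec: "A *\<^sub>v (C' *\<^sub>v y) = - (C *\<^sub>v (F' *\<^sub>v y))" if "y \<in> carrier_vec h" for y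
  proof -
    have "A *\<^sub>v (C' *\<^sub>v y) = - (C * F') *\<^sub>v y"
      using that A C' by (simp add: AC[symmetric])
    also have "\<dots> = - (C *\<^sub>v (F' *\<^sub>v y))" using that C F' by simp
    finally show ?thesis .
  qed
  show "mat_kernel ?B \<subseteq> mat_image ?B'"
  proof
    fix v assume "v \<in> mat_kernel ?B"
    then have v: "v \<in> carrier_vec (n + q)" "?B *\<^sub>v v = 0\<^sub>v (m + p)" using mat_kernelD[OF B] by auto
    obtain x y where xy: "v = x @\<^sub>v y" "x \<in> carrier_vec n" "y \<in> carrier_vec q"
      using split_vec[OF v(1)] .
    then have eq: "A *\<^sub>v x + C *\<^sub>v y = 0\<^sub>v m" "F *\<^sub>v y = 0\<^sub>v p"
      using v(2) block_mult_vec_eq_zero_iff[OF A C F xy(2,3)] by auto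
    have Ax: "A *\<^sub>v x = - (C *\<^sub>v y)"
    proof (intro eq_vecI)
      fix i assume "i < dim_vec (- (C *\<^sub>v y))"
      then have i: "i < m" using C by simp
      then have "(A *\<^sub>v x + C *\<^sub>v y) $ i = 0" using eq(1) by simp
      then show "(A *\<^sub>v x) $ i = (- (C *\<^sub>v y)) $ i"
        using i A C by (simp add: eq_neg_iff_add_eq_0)
    qed (use A C in auto)
    \<comment> \<open>This puts \<open>C y\<close> into the image of \<open>A\<close>, as
      \<open>lift\<close> demands.\<close>
    have "C *\<^sub>v y = A *\<^sub>v (- x)"
    proof -
      have "A *\<^sub>v (- x) = - (A *\<^sub>v x)" using A xy(2) by (intro eq_vecI) auto
      then show ?thesis using Ax by simp
    qed
    then have "C *\<^sub>v y \<in> mat_image A" using A xy(2) by (metis mat_imageI uminus_carrier_vec)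
    then have "y \<in> mat_image F'" using lift xy(3) eq(2) by blast
    then obtain w where w: "w \<in> carrier_vec h" "y = F' *\<^sub>v w" using mat_imageE[OF _ F'] by blast
    \<comment> \<open>With \<open>y = F' w\<close> both terms equal \<open>- C y\<close>, so the
      corrected vector is in the kernel of \<open>A\<close> and exactness provides
      \<open>u\<close>.\<close>
    have "A *\<^sub>v (x - C' *\<^sub>v w) = A *\<^sub>v x - A *\<^sub>v (C' *\<^sub>v w)"
      using A C' xy(2) w by (intro mult_minus_distrib_mat_vec) auto
    also have "\<dots> = 0\<^sub>v m"
      unfolding AC_vec[OF w(1)] Ax w(2) using C by (intro eq_vecI) auto
    finally have "x - C' *\<^sub>v w \<in> mat_kernel A" using A C' xy(2) w(1) by (intro mat_kernelI) auto
    then obtain u where u: "u \<in> carrier_vec l" "x - C' *\<^sub>v w = A' *\<^sub>v u"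
      unfolding exact using mat_imageE[OF _ A'] by blast
    have "A' *\<^sub>v u + C' *\<^sub>v w = x"
      unfolding u(2)[symmetric] using xy(2) C' by (intro eq_vecI) auto
    then have "v = ?B' *\<^sub>v (u @\<^sub>v w)"
      using block_mult_vec[OF A' C' F' u(1) w(1)] xy(1) w(2) by simp
    then show "v \<in> mat_image ?B'" using mat_imageI[OF B'] u(1) w(1) by auto
  qed
  show "mat_image ?B' \<subseteq> mat_kernel ?B"
  proof
    fix v assume "v \<in> mat_image ?B'"
    then obtain t where t: "t \<in> carrier_vec (l + h)" "v = ?B' *\<^sub>v t" using mat_imageE[OF _ B'] by blast
    obtain u w where uw: "t = u @\<^sub>v w" "u \<in> carrier_vec l" "w \<in> carrier_vec h"
      using split_vec[OF t(1)] .
    let ?x = "A' *\<^sub>v u + C' *\<^sub>v w" and ?y = "F' *\<^sub>v w"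
    have v: "v = ?x @\<^sub>v ?y" using block_mult_vec[OF A' C' F' uw(2,3)] t uw by simp
    have x: "?x \<in> carrier_vec n" and y: "?y \<in> carrier_vec q" using A' C' F' uw by auto
    have "A' *\<^sub>v u \<in> mat_kernel A" unfolding exact using mat_imageI[OF A' uw(2)] .
    then have "A *\<^sub>v (A' *\<^sub>v u) = 0\<^sub>v m" using mat_kernelD[OF A] by blast
    then have "A *\<^sub>v ?x = - (C *\<^sub>v ?y)"
      using A A' C C' F' uw AC_vec[OF uw(3)] by (simp add: mult_add_distrib_mat_vec[OF A])
    then have "A *\<^sub>v ?x + C *\<^sub>v ?y = 0\<^sub>v m" using C by (intro eq_vecI) auto
    moreover have "F *\<^sub>v ?y = 0\<^sub>v p"
    proof -
      have "F *\<^sub>v ?y = (F * F') *\<^sub>v w" using F F' uw by simp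
      also have "\<dots> = 0\<^sub>v p" unfolding FF' using uw(3) by (intro eq_vecI) auto
      finally show ?thesis .
    qed
    ultimately have "?B *\<^sub>v v = 0\<^sub>v (m + p)"
      using block_mult_vec_eq_zero_iff[OF A C F x y] v by simp
    then show "v \<in> mat_kernel ?B" using B v x y by (intro mat_kernelI[OF B]) auto
  qed
qed

lemma mult_mat_zero_vec: "A \<in> carrier_mat m n \<Longrightarrow> A *\<^sub>v 0\<^sub>v n = (0\<^sub>v m :: 'a::semiring_0 vec)"
  by (intro eq_vecI) auto

text \<open>Triangularity: \<open>F\<close> forces the lower part to be zero, and then
  \<open>A\<close> the upper part.\<close>

lemma block_injective:
  fixes A :: "'k::field bipoly mat"
  assumes A: "A \<in> carrier_mat m n" and C: "C \<in> carrier_mat m q" and F: "F \<in> carrier_mat p q"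
    and "mat_kernel A = {0\<^sub>v n}" "mat_kernel F = {0\<^sub>v q}"
  shows "mat_kernel (four_block_mat A C (0\<^sub>m p n) F) = {0\<^sub>v (n + q)}"
    (is "mat_kernel ?B = _")
proof
  have B: "?B \<in> carrier_mat (m + p) (n + q)" using A C F by auto
  show "mat_kernel ?B \<subseteq> {0\<^sub>v (n + q)}"
  proof
    fix v assume "v \<in> mat_kernel ?B"
    then have v: "v \<in> carrier_vec (n + q)" "?B *\<^sub>v v = 0\<^sub>v (m + p)" using mat_kernelD[OF B] by auto
    obtain x y where xy: "v = x @\<^sub>v y" "x \<in> carrier_vec n" "y \<in> carrier_vec q"
      using split_vec[OF v(1)] .
    then have eq: "A *\<^sub>v x + C *\<^sub>v y = 0\<^sub>v m" "F *\<^sub>v y = 0\<^sub>v p"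
      using v(2) block_mult_vec_eq_zero_iff[OF A C F xy(2,3)] by auto
    then have y: "y = 0\<^sub>v q" using mat_kernelI[OF F xy(3)] assms(5) by blast
    then have "C *\<^sub>v y = 0\<^sub>v m" using C by (intro eq_vecI) auto
    then have "A *\<^sub>v x = 0\<^sub>v m" using eq(1) A xy(2) by (metis mult_mat_vec_carrier right_zero_vec)
    then have "x = 0\<^sub>v n" using mat_kernelI[OF A xy(2)] assms(4) by blast
    then show "v \<in> {0\<^sub>v (n + q)}" using xy(1) y by (simp add: zero_append_vec)
  qed
  show "{0\<^sub>v (n + q)} \<subseteq> mat_kernel ?B"
    using mat_kernelI[OF B _ mult_mat_zero_vec[OF B]] by simp
qed

section \<open>The mapping cone with the Koszul complex\<close>

definition koszul\<^sub>1 :: "'k::field bipoly \<Rightarrow> 'k bipoly \<Rightarrow> 'k bipoly mat" where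
  "koszul\<^sub>1 l m = mat 1 2 (\<lambda>(i, j). if j = 0 then l else m)"

definition koszul\<^sub>2 :: "'k::field bipoly \<Rightarrow> 'k bipoly \<Rightarrow> 'k bipoly mat" where
  "koszul\<^sub>2 l m = mat 2 1 (\<lambda>(i, j). if i = 0 then m else - l)"

lemma koszul_carrier [simp]:
  "koszul\<^sub>1 l m \<in> carrier_mat 1 2" "koszul\<^sub>2 l m \<in> carrier_mat 2 1"
  "dim_row (koszul\<^sub>1 l m) = 1" "dim_col (koszul\<^sub>1 l m) = 2"
  "dim_row (koszul\<^sub>2 l m) = 2" "dim_col (koszul\<^sub>2 l m) = 1"
  by (simp_all add: koszul\<^sub>1_def koszul\<^sub>2_def)

lemma koszul\<^sub>1_mult_vec:
  assumes "v \<in> carrier_vec 2"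
  shows "koszul\<^sub>1 l m *\<^sub>v v = vec 1 (\<lambda>_. l * v $ 0 + m * v $ 1)"
  using assms by (intro eq_vecI) (auto simp: koszul\<^sub>1_def scalar_prod_def numeral_2_eq_2)

lemma koszul\<^sub>2_mult_vec:
  assumes "v \<in> carrier_vec 1"
  shows "koszul\<^sub>2 l m *\<^sub>v v = vec 2 (\<lambda>i. if i = 0 then m * v $ 0 else - l * v $ 0)"
  using assms by (intro eq_vecI) (auto simp: koszul\<^sub>2_def scalar_prod_def)

lemma koszul_complex: "koszul\<^sub>1 l m * koszul\<^sub>2 l m = 0\<^sub>m 1 1"
  by (intro eq_matI) (auto simp: koszul\<^sub>1_def koszul\<^sub>2_def scalar_prod_def numeral_2_eq_2)

context coordinates
begin

abbreviation "K\<^sub>1 \<equiv> koszul\<^sub>1 (xform c) (yform c)"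
abbreviation "K\<^sub>2 \<equiv> koszul\<^sub>2 (xform c) (yform c)"

lemma graded_koszul\<^sub>1: "graded_map [(i + 1, j), (i, j + 1)] [(i, j)] K\<^sub>1"
  using bihom_xform bihom_yform
  by (auto simp: graded_map_def koszul\<^sub>1_def less_Suc_eq nth_Cons')

lemma graded_koszul\<^sub>2: "graded_map [(i + 1, j + 1)] [(i + 1, j), (i, j + 1)] K\<^sub>2"
  using bihom_xform bihom_yform
  by (auto simp: graded_map_def koszul\<^sub>2_def less_Suc_eq nth_Cons' intro: bihom_uminus)

lemma koszul\<^sub>1_image:
  assumes "v \<in> carrier_vec 1" "v $ 0 = A * xform c + B * yform c"
  shows "v \<in> mat_image K\<^sub>1"
proof -
  let ?w = "vec 2 (\<lambda>i. if i = 0 then A else B)"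
  have "v = K\<^sub>1 *\<^sub>v ?w"
    using assms by (subst koszul\<^sub>1_mult_vec) (auto simp: mult.commute)
  then show ?thesis using mat_imageI[OF koszul_carrier(1), of ?w] by simp
qed

lemma koszul\<^sub>1_kernel:
  assumes "v \<in> carrier_vec 2" "K\<^sub>1 *\<^sub>v v = 0\<^sub>v 1"
  shows "v \<in> mat_image K\<^sub>2"
proof -
  have "v $ 0 * xform c + v $ 1 * yform c = (K\<^sub>1 *\<^sub>v v) $ 0"
    by (simp only: koszul\<^sub>1_mult_vec[OF assms(1)]) (simp add: mult.commute)
  then have "v $ 0 * xform c + v $ 1 * yform c = 0" using assms(2) by simp
  then obtain t where t: "v $ 0 = t * yform c" "v $ 1 = - t * xform c" by (rule koszul_exact)
  have "v = K\<^sub>2 *\<^sub>v vec 1 (\<lambda>_. t)"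
    using assms(1) t
    by (subst koszul\<^sub>2_mult_vec) (auto simp: less_2_cases_iff mult.commute)
  then show ?thesis using mat_imageI[OF koszul_carrier(2), of "vec 1 (\<lambda>_. t)"] by simp
qed

lemma koszul\<^sub>2_kernel: "mat_kernel K\<^sub>2 = {0\<^sub>v 1}"
proof
  show "mat_kernel K\<^sub>2 \<subseteq> {0\<^sub>v 1}"
  proof
    fix v assume "v \<in> mat_kernel K\<^sub>2"
    then have v: "v \<in> carrier_vec 1" "K\<^sub>2 *\<^sub>v v = 0\<^sub>v 2"
      using mat_kernelD[OF koszul_carrier(2)] by auto
    have "yform c * v $ 0 = (K\<^sub>2 *\<^sub>v v) $ 0"
      by (simp only: koszul\<^sub>2_mult_vec[OF v(1)]) simp
    then have "v $ 0 = 0" using v(2) yform_nonzero by simp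
    then have "v = 0\<^sub>v 1" using v(1) by (intro eq_vecI) auto
    then show "v \<in> {0\<^sub>v 1}" by simp
  qed
  show "{0\<^sub>v 1} \<subseteq> mat_kernel K\<^sub>2"
    using mat_kernelI[OF koszul_carrier(2) _ mult_mat_zero_vec[OF koszul_carrier(2)]] by simp
qed

end

lemma elements_block_in_variables_ideal:
  assumes "A \<in> carrier_mat m n" "C \<in> carrier_mat m q" "F \<in> carrier_mat p q"
    and "elements_mat A \<subseteq> variables_ideal" "elements_mat C \<subseteq> variables_ideal"
    and "elements_mat F \<subseteq> variables_ideal"
  shows "elements_mat (four_block_mat A C (0\<^sub>m p n) F) \<subseteq> variables_ideal"
proof -
  have "0 \<in> variables_ideal"
    using bihom_in_variables_ideal[of "(1, 0)" 0] by simp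
  then have "elements_mat (0\<^sub>m p n) \<subseteq> variables_ideal" by auto
  then show ?thesis
    by (intro order_trans[OF elements_four_block_mat[OF assms(1,2) zero_carrier_mat assms(3)]]
        Un_least assms(4-6))
qed

text \<open>Multiplication by \<open>f\<close> maps \<open>S / (xform c, yform c)\<close>, shifted
  by \<open>(r, s)\<close>, injectively into \<open>S / I\<close>. The blocks \<open>F\<close>,
  \<open>C\<close>, \<open>D\<close> lift this map, up to sign, to the Koszul complex and the given
  resolution, and its cone resolves the cokernel \<open>S / (I + (f))\<close>.\<close>

lemma (in coordinates) mapping_cone_resolution:
  fixes f :: "'k bipoly"
  assumes res: "minimal_free_resolution I a\<^sub>1 a\<^sub>2 a\<^sub>3 A\<^sub>1 A\<^sub>2 A\<^sub>3"
    and I: "ideal I polyring"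
    and f: "bihom (r, s) f" "xform c * f \<in> I" "yform c * f \<in> I"
    and colon: "\<forall>g. g * f \<in> I \<longrightarrow> (\<exists>A B. g = A * xform c + B * yform c)"
    and deg\<^sub>1: "\<And>i. i < length a\<^sub>1 \<Longrightarrow> (r + 1, s) \<noteq> a\<^sub>1 ! i \<and> (r, s + 1) \<noteq> a\<^sub>1 ! i"
    and deg\<^sub>2: "\<And>i. i < length a\<^sub>2 \<Longrightarrow> (r + 1, s + 1) \<noteq> a\<^sub>2 ! i"
  shows "\<exists>B\<^sub>1 B\<^sub>2 B\<^sub>3. minimal_free_resolution {h + g * f | h g. h \<in> I}
           (a\<^sub>1 @ [(r, s)]) (a\<^sub>2 @ [(r + 1, s), (r, s + 1)]) (a\<^sub>3 @ [(r + 1, s + 1)]) B\<^sub>1 B\<^sub>2 B\<^sub>3"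
proof -
  let ?d = "[(r + 1, s), (r, s + 1)]" and ?e = "[(r + 1, s + 1)]"
  let ?n\<^sub>1 = "length a\<^sub>1" and ?n\<^sub>2 = "length a\<^sub>2" and ?n\<^sub>3 = "length a\<^sub>3"
  have A: "graded_map a\<^sub>1 [(0, 0)] A\<^sub>1" "graded_map a\<^sub>2 a\<^sub>1 A\<^sub>2" "graded_map a\<^sub>3 a\<^sub>2 A\<^sub>3"
    and image: "(\<lambda>v. v $ 0) ` mat_image A\<^sub>1 = I"
    and exact: "mat_kernel A\<^sub>1 = mat_image A\<^sub>2" "mat_kernel A\<^sub>2 = mat_image A\<^sub>3"
      "mat_kernel A\<^sub>3 = {0\<^sub>v ?n\<^sub>3}"
    and minimal: "elements_mat A\<^sub>2 \<subseteq> variables_ideal" "elements_mat A\<^sub>3 \<subseteq> variables_ideal"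
    using res by (simp_all add: minimal_free_resolution_def)
  have car: "A\<^sub>1 \<in> carrier_mat 1 ?n\<^sub>1" "A\<^sub>2 \<in> carrier_mat ?n\<^sub>1 ?n\<^sub>2" "A\<^sub>3 \<in> carrier_mat ?n\<^sub>2 ?n\<^sub>3"
    using A[THEN graded_map_carrier] by simp_all
  \<comment> \<open>Identifies vectors of length one with their only entry.\<close>
  have in_image: "v \<in> mat_image A\<^sub>1 \<longleftrightarrow> v $ 0 \<in> I" if "v \<in> carrier_vec 1" for v
  proof
    assume "v $ 0 \<in> I"
    then obtain u where u: "u \<in> mat_image A\<^sub>1" "v $ 0 = u $ 0" unfolding image[symmetric] by blast
    then have "u \<in> carrier_vec 1" using car(1) by (auto simp: mat_image_def)
    then have "v = u" using that u(2) by (intro eq_vecI) auto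
    then show "v \<in> mat_image A\<^sub>1" using u by simp
  qed (use image in blast)
  define F where "F = mat 1 1 (\<lambda>_. f)"
  have F: "graded_map [(r, s)] [(0, 0)] F"
    using f(1) by (simp add: graded_map_def F_def)
  have F_car: "F \<in> carrier_mat 1 1" by (simp add: F_def)
  have F_vec: "F *\<^sub>v y = vec 1 (\<lambda>_. f * y $ 0)" if "y \<in> carrier_vec 1" for y
    using that by (intro eq_vecI) (auto simp: F_def scalar_prod_def)

  \<comment> \<open>The entries of \<open>F * K\<^sub>1\<close> are the products of \<open>f\<close>
    with the two forms, which lie in \<open>I\<close>. The sign makes the composite of the blocks
    zero.\<close>
  obtain C where C: "graded_map ?d a\<^sub>1 C" "A\<^sub>1 * C = - (F * K\<^sub>1)"
  proof (rule graded_lift_mat[OF A(1) graded_map_uminus[OF graded_map_mult[OF F graded_koszul\<^sub>1]]])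
    fix j assume j: "j < length ?d"
    have "col (- (F * K\<^sub>1)) j \<in> carrier_vec 1" by (simp add: F_def col_def)
    moreover have "col (- (F * K\<^sub>1)) j $ 0 = - ((if j = 0 then xform c else yform c) * f)"
      using j by (auto simp: F_def koszul\<^sub>1_def scalar_prod_def)
    ultimately show "col (- (F * K\<^sub>1)) j \<in> mat_image A\<^sub>1"
      using in_image f(2,3) ideal_class_ringD(5)[OF I] by simp
  qed
  have C_car: "C \<in> carrier_mat ?n\<^sub>1 2" using graded_map_carrier[OF C(1)] by (simp add: numeral_2_eq_2)
  \<comment> \<open>\<open>A\<^sub>1 * C * K\<^sub>2\<close> is
    \<open>- F * K\<^sub>1 * K\<^sub>2 = 0\<close>, so exactness at \<open>A\<^sub>1\<close> allows
    \<open>C * K\<^sub>2\<close> to be lifted along \<open>A\<^sub>2\<close>.\<close>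
  obtain D where D: "graded_map ?e a\<^sub>2 D" "A\<^sub>2 * D = - (C * K\<^sub>2)"
  proof (rule graded_lift_mat[OF A(2) graded_map_uminus[OF graded_map_mult[OF C(1) graded_koszul\<^sub>2]]])
    fix j assume j: "j < length ?e"
    let ?Z = "- (C * K\<^sub>2)"
    have Z: "?Z \<in> carrier_mat ?n\<^sub>1 1"
      by (rule uminus_carrier_mat[OF mult_carrier_mat[OF C_car koszul_carrier(2)]])
    have "A\<^sub>1 * ?Z = - (A\<^sub>1 * C * K\<^sub>2)"
      using car(1) C_car by (simp add: assoc_mult_mat[OF car(1) C_car koszul_carrier(2)])
    also have "\<dots> = F * (K\<^sub>1 * K\<^sub>2)"
      using F_car by (simp add: C(2) assoc_mult_mat[OF F_car koszul_carrier(1,2)])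
    also have "\<dots> = 0\<^sub>m 1 1" unfolding koszul_complex using F_car by simp
    finally have "A\<^sub>1 *\<^sub>v col ?Z j = 0\<^sub>v 1"
      using col_mult2[OF car(1) Z, of j] j by simp
    then have "col ?Z j \<in> mat_kernel A\<^sub>1"
      using car(1) Z by (intro mat_kernelI) (auto simp: col_def)
    then show "col ?Z j \<in> mat_image A\<^sub>2" using exact by simp
  qed
  have D_car: "D \<in> carrier_mat ?n\<^sub>2 1" using graded_map_carrier[OF D(1)] by simp

  \<comment> \<open>Lower blocks without rows bring \<open>B\<^sub>1\<close> into the shape that
    \<open>block_exact\<close> expects.\<close>
  define B\<^sub>1 where "B\<^sub>1 = four_block_mat A\<^sub>1 F (0\<^sub>m 0 ?n\<^sub>1) (0\<^sub>m 0 1)"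
  define B\<^sub>2 where "B\<^sub>2 = four_block_mat A\<^sub>2 C (0\<^sub>m 1 ?n\<^sub>2) K\<^sub>1"
  define B\<^sub>3 where "B\<^sub>3 = four_block_mat A\<^sub>3 D (0\<^sub>m 2 ?n\<^sub>3) K\<^sub>2"
  have "B\<^sub>1 \<in> carrier_mat (1 + 0) (?n\<^sub>1 + 1)"
    unfolding B\<^sub>1_def by (rule four_block_carrier_mat[OF car(1) zero_carrier_mat])
  then have B\<^sub>1_car: "B\<^sub>1 \<in> carrier_mat 1 (?n\<^sub>1 + 1)" by simp
  have B\<^sub>1_vec: "(B\<^sub>1 *\<^sub>v (x @\<^sub>v y)) $ 0 = (A\<^sub>1 *\<^sub>v x) $ 0 + y $ 0 * f"
    if "x \<in> carrier_vec ?n\<^sub>1" "y \<in> carrier_vec 1" for x y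
    using block_mult_vec[OF car(1) F_car, of "0\<^sub>m 0 1" 0 x y] that car(1)
    by (simp add: B\<^sub>1_def F_vec mult.commute)
  have "(\<lambda>v. v $ 0) ` mat_image B\<^sub>1 = {h + g * f | h g. h \<in> I}"
  proof
    show "(\<lambda>v. v $ 0) ` mat_image B\<^sub>1 \<subseteq> {h + g * f | h g. h \<in> I}"
    proof clarify
      fix z assume "z \<in> mat_image B\<^sub>1"
      then obtain v where v: "v \<in> carrier_vec (?n\<^sub>1 + 1)" "z = B\<^sub>1 *\<^sub>v v"
        using mat_imageE[OF _ B\<^sub>1_car] by blast
      obtain x y where xy: "v = x @\<^sub>v y" "x \<in> carrier_vec ?n\<^sub>1" "y \<in> carrier_vec 1"
        using split_vec[OF v(1)] .
      have "(A\<^sub>1 *\<^sub>v x) $ 0 \<in> I" unfolding image[symmetric] using mat_imageI[OF car(1) xy(2)] by blast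
      then show "\<exists>h g. z $ 0 = h + g * f \<and> h \<in> I" using B\<^sub>1_vec[OF xy(2,3)] v(2) xy(1) by blast
    qed
    show "{h + g * f | h g. h \<in> I} \<subseteq> (\<lambda>v. v $ 0) ` mat_image B\<^sub>1"
    proof clarify
      fix h g assume "h \<in> I"
      then obtain x where x: "x \<in> carrier_vec ?n\<^sub>1" "h = (A\<^sub>1 *\<^sub>v x) $ 0"
        unfolding image[symmetric] using mat_imageE[OF _ car(1)] by blast
      let ?v = "x @\<^sub>v vec 1 (\<lambda>_. g)"
      have "(B\<^sub>1 *\<^sub>v ?v) $ 0 = h + g * f" using B\<^sub>1_vec[OF x(1)] x(2) by simp
      moreover have "B\<^sub>1 *\<^sub>v ?v \<in> mat_image B\<^sub>1" 
        by (rule mat_imageI[OF B\<^sub>1_car append_carrier_vec[OF x(1) vec_carrier]])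
      ultimately show "h + g * f \<in> (\<lambda>v. v $ 0) ` mat_image B\<^sub>1" by (metis imageI)
    qed
  qed
  moreover have "graded_map (a\<^sub>1 @ [(r, s)]) [(0, 0)] B\<^sub>1"
    using graded_map_block[OF A(1) F, of "[]" "0\<^sub>m 0 1"] by (simp add: B\<^sub>1_def graded_map_def)
  moreover have "graded_map (a\<^sub>2 @ ?d) (a\<^sub>1 @ [(r, s)]) B\<^sub>2"
    using graded_map_block[OF A(2) C(1) graded_koszul\<^sub>1] by (simp add: B\<^sub>2_def)
  moreover have "graded_map (a\<^sub>3 @ ?e) (a\<^sub>2 @ ?d) B\<^sub>3"
    using graded_map_block[OF A(3) D(1) graded_koszul\<^sub>2] by (simp add: B\<^sub>3_def numeral_2_eq_2)
  \<comment> \<open>The lower block imposes no condition on \<open>y\<close>. What remains is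
    \<open>y $ 0 * f \<in> I\<close>, and \<open>colon\<close> expresses such a \<open>y $ 0\<close>
    through the two forms.\<close>
  moreover have "mat_kernel B\<^sub>1 = mat_image B\<^sub>2"
    unfolding B\<^sub>1_def B\<^sub>2_def
  proof (rule block_exact[OF car(1,2) F_car C_car _ koszul_carrier(1) exact(1) _ C(2)])
    fix y assume y: "y \<in> carrier_vec 1" "F *\<^sub>v y \<in> mat_image A\<^sub>1"
    then have "y $ 0 * f \<in> I" using in_image[of "F *\<^sub>v y"] F_vec by (simp add: mult.commute)
    then show "y \<in> mat_image K\<^sub>1" using colon koszul\<^sub>1_image y(1) by blast
  qed simp_all
  moreover have "mat_kernel B\<^sub>2 = mat_image B\<^sub>3"
    unfolding B\<^sub>2_def B\<^sub>3_def
    by (rule block_exact[OF car(2,3) C_car D_car koszul_carrier(1,2) exact(2) koszul_complex D(2)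
          koszul\<^sub>1_kernel])
  moreover have "mat_kernel B\<^sub>3 = {0\<^sub>v (length (a\<^sub>3 @ ?e))}"
    unfolding B\<^sub>3_def
    using block_injective[OF car(3) D_car koszul_carrier(2) exact(3) koszul\<^sub>2_kernel] by simp
  \<comment> \<open>The given diagonal block is minimal and the Koszul entries have total degree
    one; \<open>deg\<^sub>1\<close> keeps constants out of \<open>C\<close>, and below
    \<open>deg\<^sub>2\<close> does so for \<open>D\<close>.\<close>
  moreover have "elements_mat B\<^sub>2 \<subseteq> variables_ideal"
    unfolding B\<^sub>2_def
  proof (rule elements_block_in_variables_ideal[OF car(2) C_car koszul_carrier(1) minimal(1)])
    show "elements_mat C \<subseteq> variables_ideal"
      using deg\<^sub>1 by (intro elements_in_variables_ideal[OF C(1)]) (auto simp: less_Suc_eq nth_Cons')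
    show "elements_mat K\<^sub>1 \<subseteq> variables_ideal"
      by (rule elements_in_variables_ideal[OF graded_koszul\<^sub>1[of r s]])
        (auto simp: less_Suc_eq nth_Cons')
  qed
  moreover have "elements_mat B\<^sub>3 \<subseteq> variables_ideal"
    unfolding B\<^sub>3_def
  proof (rule elements_block_in_variables_ideal[OF car(3) D_car koszul_carrier(2) minimal(2)])
    show "elements_mat D \<subseteq> variables_ideal"
      using deg\<^sub>2 by (intro elements_in_variables_ideal[OF D(1)]) auto
    show "elements_mat K\<^sub>2 \<subseteq> variables_ideal"
      by (rule elements_in_variables_ideal[OF graded_koszul\<^sub>2[of r s]])
        (auto simp: less_Suc_eq nth_Cons')
  qed
  ultimately show ?thesis unfolding minimal_free_resolution_def by blast
qed

section \<open>The resolution of the residual scheme\<close>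

theorem lemma3p2:
  fixes I_Y :: "'k::alg_closed_field bipoly set"
    and J :: "'k point \<Rightarrow> 'k bipoly set"
    and P :: "'k point"
    and a\<^sub>1 a\<^sub>2 a\<^sub>3 :: "(int \<times> int) list"
    and A\<^sub>1 A\<^sub>2 A\<^sub>3 :: "'k bipoly mat"
    and r s :: nat
  assumes "zero_dim_scheme I_Y"
    and "point_decomposition I_Y J"
    and "minimal_free_resolution I_Y a\<^sub>1 a\<^sub>2 a\<^sub>3 A\<^sub>1 A\<^sub>2 A\<^sub>3"
    and "P \<in> support I_Y"
    and "multiplicity_at I_Y P = 1"
    and "{d. minimal_separating_degree I_Y J P d} = {(int r, int s)}"
    and "\<And>i. i < length a\<^sub>1 \<Longrightarrow> \<not> (int r, int s) < a\<^sub>1 ! i"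
    and "\<And>i. i < length a\<^sub>2 \<Longrightarrow> (int r + 1, int s + 1) \<noteq> a\<^sub>2 ! i"
  shows "\<exists>B\<^sub>1 B\<^sub>2 B\<^sub>3. minimal_free_resolution (remove_point I_Y J P)
           (a\<^sub>1 @ [(int r, int s)])
           (a\<^sub>2 @ [(int r + 1, int s), (int r, int s + 1)])
           (a\<^sub>3 @ [(int r + 1, int s + 1)])
           B\<^sub>1 B\<^sub>2 B\<^sub>3"
proof -
  obtain f where f: "bihom (int r, int s) f"
    and eq: "remove_point I_Y J P = {h + g * f | h g. h \<in> I_Y}"
    and colon: "xform (coords P) * f \<in> I_Y" "yform (coords P) * f \<in> I_Y"
      "\<forall>g. g * f \<in> I_Y \<longrightarrow> (\<exists>A B. g = A * xform (coords P) + B * yform (coords P))"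
    using remove_point_generated[OF assms(1,2,4,5,6)] .
  have I: "ideal I_Y polyring"
    using assms(1) by (simp add: zero_dim_scheme_def bihom_ideal_def)
  \<comment> \<open>Both Koszul degrees lie strictly above \<open>(r, s)\<close>, hence no generator
    of the ideal has one of them.\<close>
  have deg: "(int r + 1, int s) \<noteq> a\<^sub>1 ! i \<and> (int r, int s + 1) \<noteq> a\<^sub>1 ! i" if "i < length a\<^sub>1" for i
  proof -
    have "(int r, int s) < (int r + 1, int s)" "(int r, int s) < (int r, int s + 1)"
      by (auto simp: less_prod_def less_eq_prod_def)
    then show ?thesis using assms(7)[OF that] by metis
  qed
  show ?thesis
    unfolding eq
    by (rule coordinates.mapping_cone_resolution[OF coordinates_coords assms(3) I f colon deg assms(8)])
qed

end
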